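(* For $(m,p)=(4,2)$ and Schubert data $\alpha^\bullet=(J_2,J_2,J_2,J_2)$ for $\mathrm{Grass}(2,6)$, where $J_2=(1,4)$, one has $d(4,2;\alpha^\bullet)=3$ and property $\mathrm{SG}(4,2;\alpha^\bullet)$ holds.
   Context: Let $n=m+p$. $\mathrm{Grass}(p,n)$ is the Grassmannian of complex $p$-planes in $\mathbb C^n$; a complete flag $K_\bullet$ is a chain $K_1\subset\cdots\subset K_n=\mathbb C^n$, $\dim K_i=i$. A Schubert condition is $\alpha=(1\le\alpha_1<\cdots<\alpha_p\le n)$, $|\alpha|=\sum_i(\alpha_i-i)$, and $\Omega_\alpha K_\bullet=\{X\in\mathrm{Grass}(p,n):\dim(X\cap K_{n+1-\alpha_i})\ge p+1-i\ \forall i\}$. Schubert data: a sequence $(\alpha^1,\dots,\alpha^k)$ with $\sum_j|\alpha^j|=mp$; $d(m,p;\alpha^\bullet)$ is the number of points in $\bigcap_j\Omega_{\alpha^j}F^j_\bullet$ for flags in general position. $K_\bullet(s)$ ($s\in\mathbb C$) is the flag with $K_i(s)$ the row span of the first $i$ rows of the $n\times n$ matrix with $(i,j)$ entry $\binom{j-1}{i-1}s^{j-i}$. Property $\mathrm{SG}(m,p;\alpha^\bullet)$: there is a nonzero real polynomial $f$ in $k$ variables such that for all distinct reals $s_1,\dots,s_k$ with $f(s_1,\dots,s_k)\ne0$, $\bigcap_j\Omega_{\alpha^j}K_\bullet(s_j)$ consists of exactly $d(m,p;\alpha^\bullet)$ points, all real. The Pieri condition $J_a$ is $(1,2,\dots,p-1,p+a)$.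 *)

theory Defs
  imports "HOL-Analysis.Analysis" "HOL-Library.Numeral_Type"
begin

definition Grass :: "nat \<Rightarrow> (complex ^ 'n) set set" where
  "Grass p = {X. vec.subspace X \<and> vec.dim X = p}"

definition complete_flag :: "(nat \<Rightarrow> (complex ^ 'n) set) \<Rightarrow> bool" where
  "complete_flag K \<longleftrightarrow>
     (\<forall>i\<in>{1..CARD('n)}. vec.subspace (K i) \<and> vec.dim (K i) = i) \<and>
     (\<forall>i\<in>{1..<CARD('n)}. K i \<subseteq> K (Suc i)) \<and> K CARD('n) = UNIV"

definition schubert_condition :: "nat \<Rightarrow> nat \<Rightarrow> (nat \<Rightarrow> nat) \<Rightarrow> bool" where
  "schubert_condition p n \<alpha> \<longleftrightarrow>
     1 \<le> \<alpha> 1 \<and> \<alpha> p \<le> n \<and> (\<forall>i\<in>{1..<p}. \<alpha> i < \<alpha> (Suc i))"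

definition schubert_size :: "nat \<Rightarrow> (nat \<Rightarrow> nat) \<Rightarrow> nat" where
  "schubert_size p \<alpha> = (\<Sum>i=1..p. \<alpha> i - i)"

definition Omega :: "nat \<Rightarrow> (nat \<Rightarrow> nat) \<Rightarrow> (nat \<Rightarrow> (complex ^ 'n) set) \<Rightarrow> (complex ^ 'n) set set" where
  "Omega p \<alpha> K = {X \<in> Grass p. \<forall>i\<in>{1..p}.
      vec.dim (X \<inter> K (CARD('n) + 1 - \<alpha> i)) \<ge> p + 1 - i}"

definition J :: "nat \<Rightarrow> nat \<Rightarrow> (nat \<Rightarrow> nat)" where
  "J p a = (\<lambda>i. if i < p then i else p + a)"

definition nonzero_poly_fun :: "(('v::finite \<Rightarrow> 'a::comm_ring_1) \<Rightarrow> 'a) \<Rightarrow> bool" where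
  "nonzero_poly_fun f \<longleftrightarrow> (\<exists>(E :: ('v \<Rightarrow> nat) set) (c :: ('v \<Rightarrow> nat) \<Rightarrow> 'a).
      finite E \<and> E \<noteq> {} \<and> (\<forall>e\<in>E. c e \<noteq> 0) \<and>
      f = (\<lambda>x. \<Sum>e\<in>E. c e * (\<Prod>v\<in>UNIV. x v ^ e v)))"

text \<open>The flag of an n x n matrix M: K_i is the span of the first i rows.
  Rows are indexed by 'n; the coordinate positions of 'a bit0 are enumerated by Rep_bit0
  (values 0,...,n-1), so "row number r" (1-based) is the row with index position r-1.\<close>
definition idx :: "'a::finite bit0 \<Rightarrow> nat" where
  "idx j = nat (Rep_bit0 j)"

definition flag_of_matrix :: "complex ^ ('a::finite bit0) ^ ('a bit0) \<Rightarrow> nat \<Rightarrow> (complex ^ ('a bit0)) set" where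
  "flag_of_matrix M i = vec.span {M $ r | r. idx r < i}"

definition osc_matrix :: "complex \<Rightarrow> complex ^ ('a::finite bit0) ^ ('a bit0)" where
  "osc_matrix s = (\<chi> r j. of_nat (idx j choose idx r) * s ^ (idx j - idx r))"

definition osc_flag :: "complex \<Rightarrow> nat \<Rightarrow> (complex ^ ('a::finite bit0)) set" where
  "osc_flag s = flag_of_matrix (osc_matrix s)"

text \<open>d(m,p;alpha) = d: for flags in general position (the flags of k invertible matrices
  outside the zero set of a nonzero complex polynomial in their entries) the intersection
  of the Schubert varieties consists of exactly d points.\<close>
definition generic_count :: "nat \<Rightarrow> ('k::finite \<Rightarrow> nat \<Rightarrow> nat) \<Rightarrow> ('a::finite bit0) itself \<Rightarrow> nat \<Rightarrow> bool" where
  "generic_count p \<alpha> _ d \<longleftrightarrow>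
     (\<exists>g :: ('k \<times> 'a bit0 \<times> 'a bit0 \<Rightarrow> complex) \<Rightarrow> complex. nonzero_poly_fun g \<and>
       (\<forall>M :: 'k \<Rightarrow> complex ^ 'a bit0 ^ 'a bit0.
          (\<forall>k. invertible (M k)) \<and> g (\<lambda>(k, i, j). M k $ i $ j) \<noteq> 0 \<longrightarrow>
          (let S = (\<Inter>k. Omega p (\<alpha> k) (flag_of_matrix (M k))) in finite S \<and> card S = d)))"

definition real_subspace :: "(complex ^ 'n) set \<Rightarrow> bool" where
  "real_subspace X \<longleftrightarrow> (\<exists>B. (\<forall>v\<in>B. \<forall>j. Im (v $ j) = 0) \<and> X = vec.span B)"

definition SG :: "nat \<Rightarrow> ('k::finite \<Rightarrow> nat \<Rightarrow> nat) \<Rightarrow> ('a::finite bit0) itself \<Rightarrow> nat \<Rightarrow> bool" where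
  "SG p \<alpha> _ d \<longleftrightarrow>
     (\<exists>f :: ('k \<Rightarrow> real) \<Rightarrow> real. nonzero_poly_fun f \<and>
       (\<forall>s :: 'k \<Rightarrow> real. inj s \<and> f s \<noteq> 0 \<longrightarrow>
          (let S = (\<Inter>k. Omega p (\<alpha> k) (osc_flag (complex_of_real (s k))) :: (complex ^ 'a bit0) set set)
           in finite S \<and> card S = d \<and> (\<forall>X\<in>S. real_subspace X))))"

end

theory Submission
  imports Defs "HOL-Computational_Algebra.Fundamental_Theorem_Algebra"
begin

text \<open>A point of the intersection is a plane in \<open>\<complex>\<^sup>6\<close> that meets four given 3-spaces \<open>A, B, C, D\<close>. If
  \<open>\<complex>\<^sup>6 = A \<oplus> B\<close>, then \<open>C\<close> and \<open>D\<close> are graphs of linear maps from \<open>A\<close> to \<open>B\<close>, and the planes correspond to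
  the eigenvectors of the quotient of these two maps. So there are three of them as soon as a
  cubic discriminant, polynomial in the flags, does not vanish.

  For osculating 3-spaces, view \<open>\<complex>\<^sup>6\<close> as the binary quintics; the 3-space at \<open>s\<close> is the set of
  multiples of \<open>(x + s) ^ 3\<close>. In a basis of monomials in the linear forms of the first and second point,
  the pencil depends only on a cross ratio \<open>t\<close>. Sorting the four real points makes the first and second
  separate the other two, so that \<open>t < 0\<close>, and then sign changes give three distinct real eigenvalues.\<close>

section \<open>Planes meeting four subspaces\<close>

lemma span_range_eq:
  fixes v :: "'m::finite \<Rightarrow> 'a::field ^ 'n"
  shows "vec.span (range v) = range (\<lambda>x. \<Sum>i\<in>UNIV. x i *s v i)"
proof
  have "vec.subspace (range (\<lambda>x. \<Sum>i\<in>UNIV. x i *s v i))"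
  proof (rule vec.subspaceI)
    show "0 \<in> range (\<lambda>x. \<Sum>i\<in>UNIV. x i *s v i)"
      by (rule image_eqI[of _ _ "\<lambda>_. 0"]) auto
  next
    fix u w assume "u \<in> range (\<lambda>x. \<Sum>i\<in>UNIV. x i *s v i)" "w \<in> range (\<lambda>x. \<Sum>i\<in>UNIV. x i *s v i)"
    then obtain x y where "u = (\<Sum>i\<in>UNIV. x i *s v i)" "w = (\<Sum>i\<in>UNIV. y i *s v i)" by blast
    then have "u + w = (\<Sum>i\<in>UNIV. (x i + y i) *s v i)"
      by (simp add: sum.distrib vec.scale_left_distrib)
    then show "u + w \<in> range (\<lambda>x. \<Sum>i\<in>UNIV. x i *s v i)"
      by (intro image_eqI[of _ _ "\<lambda>i. x i + y i"]) simp_all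
  next
    fix c u assume "u \<in> range (\<lambda>x. \<Sum>i\<in>UNIV. x i *s v i)"
    then obtain x where "u = (\<Sum>i\<in>UNIV. x i *s v i)" by blast
    then have "c *s u = (\<Sum>i\<in>UNIV. (c * x i) *s v i)"
      by (simp add: vec.scale_sum_right)
    then show "c *s u \<in> range (\<lambda>x. \<Sum>i\<in>UNIV. x i *s v i)"
      by (intro image_eqI[of _ _ "\<lambda>i. c * x i"]) simp_all
  qed
  moreover have "range v \<subseteq> range (\<lambda>x. \<Sum>i\<in>UNIV. x i *s v i)"
  proof clarify
    fix i
    have "v i = (\<Sum>j\<in>UNIV. (if j = i then 1 else 0) *s v j)"
      by (simp add: if_distrib[of "\<lambda>c. c *s _"] cong: if_cong)
    then show "v i \<in> range (\<lambda>x. \<Sum>i\<in>UNIV. x i *s v i)"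
      by (intro image_eqI[of _ _ "\<lambda>j. if j = i then 1 else 0"]) simp_all
  qed
  ultimately show "vec.span (range v) \<subseteq> range (\<lambda>x. \<Sum>i\<in>UNIV. x i *s v i)"
    by (rule vec.span_minimal[rotated])
  show "range (\<lambda>x. \<Sum>i\<in>UNIV. x i *s v i) \<subseteq> vec.span (range v)"
    by (auto intro!: vec.span_sum vec.span_scale intro: vec.span_base)
qed

lemma inj_independent_family:
  fixes v :: "'m::finite \<Rightarrow> 'a::field ^ 'n"
  assumes ind: "\<And>x. (\<Sum>i\<in>UNIV. x i *s v i) = 0 \<Longrightarrow> \<forall>i. x i = 0"
  shows "inj v" "vec.independent (range v)"
proof -
  show inj: "inj v"
  proof (rule injI, rule ccontr)
    fix i j assume eq: "v i = v j" and ne: "i \<noteq> j"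
    have "(\<Sum>k\<in>UNIV. ((if k = i then 1 else 0) - (if k = j then 1 else 0)) *s v k) = v i - v j"
      by (simp add: vec.scale_left_diff_distrib sum_subtractf if_distrib[of "\<lambda>c. c *s _"] cong: if_cong)
    with eq have "(\<Sum>k\<in>UNIV. ((if k = i then 1 else 0) - (if k = j then 1 else 0)) *s v k) = 0"
      by simp
    from ind[OF this] have "(if i = i then 1 else 0) - (if i = j then 1 else 0) = (0::'a)" by blast
    with ne show False by simp
  qed
  show "vec.independent (range v)"
    unfolding vec.independent_explicit
  proof (intro conjI allI impI ballI)
    fix c w assume "(\<Sum>w\<in>range v. c w *s w) = 0" "w \<in> range v"
    then show "c w = 0"
      using ind[of "\<lambda>i. c (v i)"] by (auto simp: sum.reindex[OF inj])
  qed auto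
qed

text \<open>An independent family as large as the dimension bound spans. This is what turns
  membership in one of the four spaces into coordinates.\<close>

lemma subspace_eq_combinations:
  fixes v :: "'m::finite \<Rightarrow> 'a::field ^ 'n"
  assumes ind: "\<And>x. (\<Sum>i\<in>UNIV. x i *s v i) = 0 \<Longrightarrow> \<forall>i. x i = 0"
    and U: "vec.dim U \<le> CARD('m)" and v: "\<And>i. v i \<in> U" and w: "w \<in> U"
  obtains x where "w = (\<Sum>i\<in>UNIV. x i *s v i)"
proof -
  note iv = inj_independent_family[of v, OF ind]
  have "U \<subseteq> vec.span (range v)"
    using iv U v by (intro vec.card_ge_dim_independent) (auto simp: card_image)
  with w that show thesis by (auto simp: span_range_eq)
qed

lemma dim_ge_1_iff: "1 \<le> vec.dim (S :: ('a::field ^ 'n) set) \<longleftrightarrow> (\<exists>v\<in>S. v \<noteq> 0)"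
proof -
  have "1 \<le> vec.dim S \<longleftrightarrow> \<not> S \<subseteq> {0}"
    using vec.dim_eq_0[of S] by linarith
  also have "\<dots> \<longleftrightarrow> (\<exists>v\<in>S. v \<noteq> 0)" by auto
  finally show ?thesis .
qed

text \<open>In the bases \<open>a\<close> and \<open>b\<close>, the spaces \<open>C\<close> and
  \<open>D\<close> are the graphs of the identity and of the diagonal map \<open>l\<close>. If a
  plane is spanned by \<open>u\<close> in \<open>A\<close> and \<open>v\<close> in \<open>B\<close>,
  its vector in \<open>C\<close> makes the coordinates of \<open>v\<close> proportional to those of
  \<open>u\<close>, and its vector in \<open>D\<close> then makes \<open>l\<close> constant on their
  support. As \<open>l\<close> is injective, the support is a single index.\<close>

lemma transversals_diagonal:
  fixes a b :: "'m::finite \<Rightarrow> complex ^ 'n" and l :: "'m \<Rightarrow> complex"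
  assumes ind: "\<And>x y. (\<Sum>i\<in>UNIV. x i *s a i) + (\<Sum>i\<in>UNIV. y i *s b i) = 0 \<Longrightarrow> \<forall>i. x i = 0 \<and> y i = 0"
    and l: "inj l"
    and dims: "vec.dim A \<le> CARD('m)" "vec.dim B \<le> CARD('m)" "vec.dim C \<le> CARD('m)" "vec.dim D \<le> CARD('m)"
    and mem: "\<And>i. a i \<in> A" "\<And>i. b i \<in> B" "\<And>i. a i + b i \<in> C" "\<And>i. a i + l i *s b i \<in> D"
  shows "{X. vec.subspace X \<and> vec.dim X = 2 \<and> (\<forall>Y\<in>{A, B, C, D}. 1 \<le> vec.dim (X \<inter> Y))}
           = range (\<lambda>i. vec.span {a i, b i})"
    and "inj (\<lambda>i. vec.span {a i, b i})"
proof -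
  have ind2: "x i = x' i \<and> y i = y' i"
    if "(\<Sum>i\<in>UNIV. x i *s a i) + (\<Sum>i\<in>UNIV. y i *s b i) =
        (\<Sum>i\<in>UNIV. x' i *s a i) + (\<Sum>i\<in>UNIV. y' i *s b i)" for x y x' y' i
  proof -
    have "(\<Sum>i\<in>UNIV. (x i - x' i) *s a i) + (\<Sum>i\<in>UNIV. (y i - y' i) *s b i) = 0"
      using that by (simp add: vec.scale_left_diff_distrib sum_subtractf algebra_simps)
    from ind[OF this] show ?thesis by simp
  qed
  have single: "(\<Sum>j\<in>UNIV. (if j = i then c else 0) *s v j) = c *s v i" for i c and v :: "'m \<Rightarrow> complex ^ 'n"
    by (simp add: if_distrib[of "\<lambda>c. c *s _"] cong: if_cong)
  have inda: "\<forall>i. x i = 0" if "(\<Sum>i\<in>UNIV. x i *s a i) = 0" for x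
    using ind[of x "\<lambda>_. 0"] that by simp
  have indb: "\<forall>i. x i = 0" if "(\<Sum>i\<in>UNIV. x i *s b i) = 0" for x
    using ind[of "\<lambda>_. 0" x] that by simp
  have splitab: "(\<Sum>i\<in>UNIV. x i *s (a i + c i *s b i)) =
      (\<Sum>i\<in>UNIV. x i *s a i) + (\<Sum>i\<in>UNIV. (x i * c i) *s b i)" for x c
    by (simp add: vec.scale_right_distrib sum.distrib)
  have indc: "\<forall>i. x i = 0" if "(\<Sum>i\<in>UNIV. x i *s (a i + c i *s b i)) = 0" for x c
    using ind[of x "\<lambda>i. x i * c i"] that unfolding splitab by simp
  have pair: "s = 0 \<and> t = 0" if "s *s a i + t *s b j = 0" for s t i j
    using ind[of "\<lambda>k. if k = i then s else 0" "\<lambda>k. if k = j then t else 0"] that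
    unfolding single by (metis (full_types))
  have two: "vec.dim (vec.span {u, v}) = 2" "vec.independent {u, v}" "u \<noteq> v"
    if "\<And>s t. s *s u + t *s v = 0 \<Longrightarrow> s = 0 \<and> t = 0" for u v :: "complex ^ 'n"
  proof -
    show ne: "u \<noteq> v" using that[of 1 "-1"] by auto
    show i: "vec.independent {u, v}"
      unfolding vec.independent_explicit using ne that by auto
    show "vec.dim (vec.span {u, v}) = 2"
      using vec.dim_eq_card_independent[OF i] ne by simp
  qed
  have in2: "\<exists>s t. w = s *s u + t *s v" if w: "w \<in> vec.span {u, v}" for u v w :: "complex ^ 'n"
  proof -
    obtain s where "w - s *s u \<in> vec.span {v}"
      using w by (auto simp: vec.span_breakdown_eq[of w u])
    then obtain t where "w - s *s u = t *s v"
      by (auto simp: vec.span_singleton)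
    then have "w = s *s u + t *s v" by (simp add: algebra_simps)
    then show ?thesis by blast
  qed
  have inc: "s *s u + t *s v \<in> vec.span {u, v}" for s t and u v :: "complex ^ 'n"
    by (intro vec.span_add vec.span_scale vec.span_base) auto
  have nz: "\<exists>i. x i \<noteq> 0" if "(\<Sum>i\<in>UNIV. x i *s v i) \<noteq> 0" for x and v :: "'m \<Rightarrow> complex ^ 'n"
  proof (rule ccontr)
    assume "\<nexists>i. x i \<noteq> 0"
    then show False using that by simp
  qed
  \<comment> \<open>The factor 1 gives \<open>C\<close> the same shape as \<open>D\<close>, so that
    \<open>splitab\<close> and \<open>indc\<close> serve both.\<close>
  have mem3: "a i + 1 *s b i \<in> C" for i using mem(3)[of i] by simp
  have neab: "a i \<noteq> 0" "b i \<noteq> 0" "a i + c *s b i \<noteq> 0" for i c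
  proof -
    show "a i \<noteq> 0" using pair[of 1 i 0 i] by force
    show "b i \<noteq> 0" using pair[of 0 i 1 i] by force
    show "a i + c *s b i \<noteq> 0" using pair[of 1 i c i] by force
  qed
  show "{X. vec.subspace X \<and> vec.dim X = 2 \<and> (\<forall>Y\<in>{A, B, C, D}. 1 \<le> vec.dim (X \<inter> Y))}
           = range (\<lambda>i. vec.span {a i, b i})" (is "?L = ?R")
  proof
    show "?R \<subseteq> ?L"
    proof clarify
      fix i
      have "a i \<in> vec.span {a i, b i} \<inter> A" "b i \<in> vec.span {a i, b i} \<inter> B"
        "a i + 1 *s b i \<in> vec.span {a i, b i} \<inter> C" "a i + l i *s b i \<in> vec.span {a i, b i} \<inter> D"
        using mem[of i] inc[of 1 "a i" "l i" "b i"] inc[of 1 "a i" 1 "b i"]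
        by (auto intro: vec.span_base)
      then show "vec.subspace (vec.span {a i, b i}) \<and> vec.dim (vec.span {a i, b i}) = 2 \<and>
          (\<forall>Y\<in>{A, B, C, D}. 1 \<le> vec.dim (vec.span {a i, b i} \<inter> Y))"
        unfolding dim_ge_1_iff using two(1)[OF pair] neab(1,2)[of i] neab(3)[of i 1] neab(3)[of i "l i"]
        by (auto simp del: One_nat_def)
    qed
    show "?L \<subseteq> ?R"
    proof clarify
      fix X assume X: "vec.subspace X" "vec.dim X = 2" "\<forall>Y\<in>{A, B, C, D}. 1 \<le> vec.dim (X \<inter> Y)"
      from X(3) obtain u v w w' where
        uA: "u \<in> X" "u \<in> A" "u \<noteq> 0" and vB: "v \<in> X" "v \<in> B" "v \<noteq> 0" and
        wC: "w \<in> X" "w \<in> C" "w \<noteq> 0" and wD: "w' \<in> X" "w' \<in> D" "w' \<noteq> 0"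
        unfolding dim_ge_1_iff by auto
      obtain x where x: "u = (\<Sum>i\<in>UNIV. x i *s a i)"
        using subspace_eq_combinations[where v = a, OF inda dims(1) mem(1) uA(2)] by blast
      obtain y where y: "v = (\<Sum>i\<in>UNIV. y i *s b i)"
        using subspace_eq_combinations[where v = b, OF indb dims(2) mem(2) vB(2)] by blast
      obtain z where z: "w = (\<Sum>i\<in>UNIV. z i *s (a i + 1 *s b i))"
        using subspace_eq_combinations[where v = "\<lambda>i. a i + 1 *s b i", OF indc[where c = "\<lambda>_. 1"] dims(3) mem3 wC(2)]
        by blast
      obtain z' where z': "w' = (\<Sum>i\<in>UNIV. z' i *s (a i + l i *s b i))"
        using subspace_eq_combinations[where v = "\<lambda>i. a i + l i *s b i", OF indc[where c = l] dims(4) mem(4) wD(2)]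
        by blast
      obtain i where i: "x i \<noteq> 0" using uA(3) nz unfolding x by blast
      obtain j where j: "y j \<noteq> 0" using vB(3) nz unfolding y by blast
      have uv: "s = 0 \<and> t = 0" if "s *s u + t *s v = 0" for s t
      proof -
        have "\<forall>i. s * x i = 0 \<and> t * y i = 0"
          using ind[of "\<lambda>i. s * x i" "\<lambda>i. t * y i"] that unfolding x y
          by (simp add: vec.scale_sum_right)
        then show ?thesis using i j by auto
      qed
      \<comment> \<open>By \<open>uv\<close> the two vectors are independent, so they already fill
        the plane.\<close>
      have Xsub: "X \<subseteq> vec.span {u, v}"
      proof (rule vec.card_ge_dim_independent)
        show "{u, v} \<subseteq> X" using uA(1) vB(1) by simp
        show "vec.independent {u, v}" by (rule two(2)[OF uv])
        show "vec.dim X \<le> card {u, v}" using X(2) two(3)[OF uv] by simp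
      qed
      obtain \<alpha> \<beta> where "w = \<alpha> *s u + \<beta> *s v" using Xsub wC(1) in2 by blast
      \<comment> \<open>Coordinates in the joint basis \<open>a\<close>, \<open>b\<close> are
        unique: a vector of \<open>C\<close> has equal \<open>a\<close>- and
        \<open>b\<close>-coordinates, a vector of \<open>D\<close> has them in the ratio
        \<open>l\<close>.\<close>
      then have zz: "z k = \<alpha> * x k \<and> z k = \<beta> * y k" for k
        unfolding x y z splitab
        by (intro ind2[of z z "\<lambda>k. \<alpha> * x k" "\<lambda>k. \<beta> * y k" k]) (simp add: vec.scale_sum_right)
      obtain \<gamma> \<delta> where "w' = \<gamma> *s u + \<delta> *s v" using Xsub wD(1) in2 by blast
      then have zz': "z' k = \<gamma> * x k \<and> z' k * l k = \<delta> * y k" for k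
        unfolding x y z' splitab
        by (intro ind2[of z' "\<lambda>k. z' k * l k" "\<lambda>k. \<gamma> * x k" "\<lambda>k. \<delta> * y k" k])
          (simp add: vec.scale_sum_right)
      obtain k where "z k \<noteq> 0" using nz[of z "\<lambda>i. a i + 1 *s b i"] wC(3) unfolding z by blast
      then have ab: "\<alpha> \<noteq> 0" "\<beta> \<noteq> 0" using zz[of k] by auto
      obtain k' where "z' k' \<noteq> 0" using nz[of z' "\<lambda>i. a i + l i *s b i"] wD(3) unfolding z' by blast
      then have c: "\<gamma> \<noteq> 0" using zz'[of k'] by auto
      have yx: "y k = \<alpha> / \<beta> * x k" for k
        using zz[of k] ab by (auto simp: field_simps)
      \<comment> \<open>The right-hand side does not involve \<open>k\<close>, so \<open>l\<close>
        is constant on the support of \<open>x\<close>.\<close>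
      have lk: "l k = \<delta> * \<alpha> / (\<beta> * \<gamma>)" if "x k \<noteq> 0" for k
      proof -
        have "\<gamma> * x k * l k = \<delta> * (\<alpha> / \<beta> * x k)" using zz'[of k] yx[of k] by metis
        then show ?thesis using that ab c by (simp add: field_simps)
      qed
      have x0: "x k = 0" if "k \<noteq> i" for k
      proof (rule ccontr)
        assume "x k \<noteq> 0"
        then have "l k = l i" using lk[OF i] lk[of k] by simp
        with l that show False by (simp add: inj_eq)
      qed
      have u: "u = x i *s a i"
      proof -
        have "u = (\<Sum>j\<in>UNIV. (if j = i then x i else 0) *s a j)"
          unfolding x using x0 by (intro sum.cong) auto
        then show ?thesis unfolding single .
      qed
      have v: "v = y i *s b i"
      proof -
        have "v = (\<Sum>j\<in>UNIV. (if j = i then y i else 0) *s b j)"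
          unfolding y using x0 yx by (intro sum.cong) auto
        then show ?thesis unfolding single .
      qed
      have yi: "y i \<noteq> 0" using yx[of i] i ab by simp
      have "a i = inverse (x i) *s u" "b i = inverse (y i) *s v"
        using u v i yi by simp_all
      then have "{a i, b i} \<subseteq> X" using X(1) uA(1) vB(1) by (simp add: vec.subspace_scale)
      then have "vec.span {a i, b i} \<subseteq> X" using X(1) by (simp add: vec.span_minimal)
      moreover have "vec.span {u, v} \<subseteq> vec.span {a i, b i}"
        using inc[of "x i" "a i" 0 "b i"] inc[of 0 "a i" "y i" "b i"]
        by (intro vec.span_minimal) (auto simp: u v)
      ultimately have "X = vec.span {a i, b i}" using Xsub by blast
      then show "X \<in> ?R" by blast
    qed
  qed
  show "inj (\<lambda>i. vec.span {a i, b i})"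
  proof (rule injI, rule ccontr)
    fix i j assume eq: "vec.span {a i, b i} = vec.span {a j, b j}" and ne: "i \<noteq> j"
    have "a i \<in> vec.span {a j, b j}" using eq by (metis insertI1 vec.span_base)
    then obtain s t where "a i = s *s a j + t *s b j" using in2 by blast
    \<comment> \<open>The zero function is written \<open>if k = i then 0 else 0\<close> so that
      \<open>single\<close> collapses that sum as well.\<close>
    then have "(if i = i then 1 else 0) = (if i = j then s else 0)"
      using ind2[of "\<lambda>k. if k = i then 1 else 0" "\<lambda>k. if k = i then 0 else 0"
          "\<lambda>k. if k = j then s else 0" "\<lambda>k. if k = j then t else 0" i]
      unfolding single by simp
    with ne show False by simp
  qed
qed

lemma det_nonzero_iff_rows:
  fixes A :: "'a::field ^ 'n ^ 'n"
  shows "det A \<noteq> 0 \<longleftrightarrow> (\<forall>c. (\<forall>j. (\<Sum>i\<in>UNIV. c i * A $ i $ j) = 0) \<longrightarrow> (\<forall>i. c i = 0))"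
  unfolding invertible_det_nz[symmetric] invertible_right_inverse matrix_right_invertible_independent_rows
  by (simp add: vec_eq_iff row_def)

text \<open>Row eigenvectors of the pencil reduce this to the diagonal case. With the new vectors
  \<open>p * z i\<close> in terms of \<open>a\<close> and \<open>z i * W\<close> in terms of
  \<open>b\<close>, their sum lies in \<open>C\<close>. The combination of generators of
  \<open>D\<close> by \<open>z i\<close>, rescaled by \<open>p / r\<close>, has the same first part,
  while its second part is multiplied by \<open>p / (r * lam i)\<close>. The factors
  \<open>p\<close> and \<open>r\<close> admit graphs whose denominators have been cleared.\<close>

lemma transversals_pencil:
  fixes a b :: "3 \<Rightarrow> complex ^ 'n" and W W' :: "complex ^ 3 ^ 3" and z :: "3 \<Rightarrow> 3 \<Rightarrow> complex"
  assumes ind: "\<And>x y. (\<Sum>i\<in>UNIV. x i *s a i) + (\<Sum>i\<in>UNIV. y i *s b i) = 0 \<Longrightarrow> \<forall>i. x i = 0 \<and> y i = 0"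
    and W: "det W \<noteq> 0" "det W' \<noteq> 0" and lam: "inj lam" and pr: "p \<noteq> 0" "r \<noteq> 0"
    and z: "\<And>i. \<exists>h. z i h \<noteq> 0"
    and eig: "\<And>i j. (\<Sum>h\<in>UNIV. z i h * W $ h $ j) = lam i * (\<Sum>h\<in>UNIV. z i h * W' $ h $ j)"
    and sub: "vec.subspace A" "vec.subspace B" "vec.subspace C" "vec.subspace D"
    and dims: "vec.dim A \<le> 3" "vec.dim B \<le> 3" "vec.dim C \<le> 3" "vec.dim D \<le> 3"
    and mem: "\<And>h. a h \<in> A" "\<And>h. b h \<in> B" "\<And>h. p *s a h + (\<Sum>j\<in>UNIV. W $ h $ j *s b j) \<in> C"
      "\<And>h. r *s a h + (\<Sum>j\<in>UNIV. W' $ h $ j *s b j) \<in> D"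
  defines "F \<equiv> \<lambda>i. vec.span {\<Sum>h\<in>UNIV. (p * z i h) *s a h, \<Sum>j\<in>UNIV. (\<Sum>h\<in>UNIV. z i h * W $ h $ j) *s b j}"
  shows "{X. vec.subspace X \<and> vec.dim X = 2 \<and> (\<forall>Y\<in>{A, B, C, D}. 1 \<le> vec.dim (X \<inter> Y))} = range F"
    and "inj F"
proof -
  have Winj: "c h = 0" if "\<And>j. (\<Sum>h\<in>UNIV. c h * W $ h $ j) = 0" for c h
    using W(1) that unfolding det_nonzero_iff_rows by blast
  have W'inj: "c h = 0" if "\<And>j. (\<Sum>h\<in>UNIV. c h * W' $ h $ j) = 0" for c h
    using W(2) that unfolding det_nonzero_iff_rows by blast
  \<comment> \<open>A zero eigenvalue would put the nonzero row \<open>z i\<close> into the left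
    kernel of \<open>W\<close>.\<close>
  have lam0: "lam i \<noteq> 0" for i
    using z[of i] Winj[of "z i"] eig[of i] by fastforce
  \<comment> \<open>Multiplying the row by \<open>W'\<close> and using the eigenvalue equation gives
    the original relation multiplied by \<open>W\<close>, which is 0; \<open>W'\<close> is injective
    on rows.\<close>
  have zlam: "(\<Sum>i\<in>UNIV. x i * lam i * z i h) = 0" if "\<And>h. (\<Sum>i\<in>UNIV. x i * z i h) = 0" for x h
  proof (rule W'inj)
    fix j
    have "(\<Sum>h\<in>UNIV. (\<Sum>i\<in>UNIV. x i * lam i * z i h) * W' $ h $ j)
        = (\<Sum>h\<in>UNIV. \<Sum>i\<in>UNIV. x i * lam i * z i h * W' $ h $ j)"
      by (simp add: sum_distrib_right)
    also have "\<dots> = (\<Sum>i\<in>UNIV. x i * (lam i * (\<Sum>h\<in>UNIV. z i h * W' $ h $ j)))"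
      by (subst sum.swap) (simp add: sum_distrib_left mult.assoc)
    also have "\<dots> = (\<Sum>i\<in>UNIV. \<Sum>h\<in>UNIV. x i * z i h * W $ h $ j)"
      by (simp only: eig[symmetric]) (simp add: sum_distrib_left mult.assoc)
    also have "\<dots> = (\<Sum>h\<in>UNIV. (\<Sum>i\<in>UNIV. x i * z i h) * W $ h $ j)"
      by (subst sum.swap) (simp add: sum_distrib_right)
    finally show "(\<Sum>h\<in>UNIV. (\<Sum>i\<in>UNIV. x i * lam i * z i h) * W' $ h $ j) = 0"
      using that by simp
  qed
  have zind: "x i = 0" if x: "\<And>h. (\<Sum>i\<in>UNIV. x i * z i h) = 0" for x i
  proof -
    have e0: "x 1 * z 1 h + x 2 * z 2 h + x 3 * z 3 h = 0" for h
      using x[of h] by (simp add: sum_3)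
    have e1: "x 1 * lam 1 * z 1 h + x 2 * lam 2 * z 2 h + x 3 * lam 3 * z 3 h = 0" for h
      using zlam[OF x, of h] by (simp add: sum_3)
    have e2: "x 1 * lam 1 * lam 1 * z 1 h + x 2 * lam 2 * lam 2 * z 2 h + x 3 * lam 3 * lam 3 * z 3 h = 0" for h
      using zlam[OF zlam[OF x], of h] by (simp add: sum_3)
    \<comment> \<open>Elimination as for a Vandermonde system:
      \<open>e2 - (lam 2 + lam 3) * e1 + lam 2 * lam 3 * e0\<close> isolates the first term, and
      similarly for the others.\<close>
    have "x 1 * (lam 1 - lam 2) * (lam 1 - lam 3) * z 1 h = 0"
         "x 2 * (lam 2 - lam 1) * (lam 2 - lam 3) * z 2 h = 0"
         "x 3 * (lam 3 - lam 1) * (lam 3 - lam 2) * z 3 h = 0" for h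
      using e0[of h] e1[of h] e2[of h] by algebra+
    moreover have "lam 1 \<noteq> lam 2" "lam 1 \<noteq> lam 3" "lam 2 \<noteq> lam 3"
      using lam by (simp_all add: inj_eq)
    ultimately have "x 1 = 0 \<and> x 2 = 0 \<and> x 3 = 0"
      using z[of 1] z[of 2] z[of 3] by (metis eq_iff_diff_eq_0 mult_eq_0_iff)
    then show ?thesis using exhaust_3[of i] by auto
  qed
  have ind': "\<forall>i. x i = 0 \<and> y i = 0"
    if "(\<Sum>i\<in>UNIV. x i *s (\<Sum>h\<in>UNIV. (p * z i h) *s a h)) +
        (\<Sum>i\<in>UNIV. y i *s (\<Sum>j\<in>UNIV. (\<Sum>h\<in>UNIV. z i h * W $ h $ j) *s b j)) = 0" for x y
  proof -
    have 1: "(\<Sum>i\<in>UNIV. x i *s (\<Sum>h\<in>UNIV. (p * z i h) *s a h))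
        = (\<Sum>h\<in>UNIV. (p * (\<Sum>i\<in>UNIV. x i * z i h)) *s a h)"
      by (simp add: vec.scale_sum_right vec.scale_sum_left sum_distrib_left mult.left_commute)
         (rule sum.swap)
    have 2: "(\<Sum>i\<in>UNIV. y i *s (\<Sum>j\<in>UNIV. (\<Sum>h\<in>UNIV. z i h * W $ h $ j) *s b j))
        = (\<Sum>j\<in>UNIV. (\<Sum>i\<in>UNIV. y i * (\<Sum>h\<in>UNIV. z i h * W $ h $ j)) *s b j)"
      unfolding vec.scale_sum_right vec.scale_sum_left[where f = "\<lambda>i. y i * _ i"] vec.scale_scale by (rule sum.swap)
    have i: "p * (\<Sum>i\<in>UNIV. x i * z i h) = 0" "(\<Sum>i\<in>UNIV. y i * (\<Sum>h\<in>UNIV. z i h * W $ h $ h')) = 0" for h h'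
      using ind[OF that[unfolded 1 2]] by blast+
    have "(\<Sum>h\<in>UNIV. (\<Sum>i\<in>UNIV. y i * z i h) * W $ h $ j) = 0" for j
    proof -
      have "(\<Sum>h\<in>UNIV. (\<Sum>i\<in>UNIV. y i * z i h) * W $ h $ j)
          = (\<Sum>i\<in>UNIV. y i * (\<Sum>h\<in>UNIV. z i h * W $ h $ j))"
        by (simp add: sum_distrib_right sum_distrib_left mult.assoc) (rule sum.swap)
      with i show ?thesis by simp
    qed
    then have "(\<Sum>i\<in>UNIV. y i * z i h) = 0" for h by (rule Winj)
    with zind i(1) pr(1) show ?thesis by simp
  qed
  define l where "l i = p / (r * lam i)" for i
  have l: "inj l" using lam lam0 pr by (auto simp: inj_def l_def field_simps)
  have comb: "(\<Sum>h\<in>UNIV. z i h *s (q *s a h + (\<Sum>j\<in>UNIV. V $ h $ j *s b j))) =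
     (\<Sum>h\<in>UNIV. (q * z i h) *s a h) + (\<Sum>j\<in>UNIV. (\<Sum>h\<in>UNIV. z i h * V $ h $ j) *s b j)"
    for i q and V :: "complex ^ 3 ^ 3"
  proof -
    have "(\<Sum>h\<in>UNIV. z i h *s (\<Sum>j\<in>UNIV. V $ h $ j *s b j)) = (\<Sum>j\<in>UNIV. (\<Sum>h\<in>UNIV. z i h * V $ h $ j) *s b j)"
      by (simp add: vec.scale_sum_right vec.scale_sum_left) (rule sum.swap)
    then show ?thesis
      by (simp add: vec.scale_right_distrib sum.distrib mult.commute)
  qed
  have mA: "(\<Sum>h\<in>UNIV. (p * z i h) *s a h) \<in> A" for i
    by (intro vec.subspace_sum vec.subspace_scale sub mem)
  have mB: "(\<Sum>j\<in>UNIV. (\<Sum>h\<in>UNIV. z i h * W $ h $ j) *s b j) \<in> B" for i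
    by (intro vec.subspace_sum vec.subspace_scale sub mem)
  have mC: "(\<Sum>h\<in>UNIV. (p * z i h) *s a h) + (\<Sum>j\<in>UNIV. (\<Sum>h\<in>UNIV. z i h * W $ h $ j) *s b j) \<in> C" for i
    unfolding comb[symmetric] by (intro vec.subspace_sum vec.subspace_scale sub mem)
  have mD: "(\<Sum>h\<in>UNIV. (p * z i h) *s a h) + l i *s (\<Sum>j\<in>UNIV. (\<Sum>h\<in>UNIV. z i h * W $ h $ j) *s b j) \<in> D" for i
  proof -
    have "(p / r) *s (\<Sum>h\<in>UNIV. z i h *s (r *s a h + (\<Sum>j\<in>UNIV. W' $ h $ j *s b j))) \<in> D"
      by (intro vec.subspace_sum vec.subspace_scale sub mem)
    also have "(p / r) *s (\<Sum>h\<in>UNIV. z i h *s (r *s a h + (\<Sum>j\<in>UNIV. W' $ h $ j *s b j)))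
        = (\<Sum>h\<in>UNIV. (p * z i h) *s a h) + l i *s (\<Sum>j\<in>UNIV. (\<Sum>h\<in>UNIV. z i h * W $ h $ j) *s b j)"
      unfolding comb eig l_def using pr lam0[of i]
      by (simp add: vec.scale_right_distrib vec.scale_sum_right)
    finally show ?thesis .
  qed
  have dims': "vec.dim A \<le> CARD(3)" "vec.dim B \<le> CARD(3)" "vec.dim C \<le> CARD(3)" "vec.dim D \<le> CARD(3)"
    using dims by simp_all
  note R = transversals_diagonal[OF ind' l dims' mA mB mC mD]
  show "{X. vec.subspace X \<and> vec.dim X = 2 \<and> (\<forall>Y\<in>{A, B, C, D}. 1 \<le> vec.dim (X \<inter> Y))} = range F"
    unfolding F_def by (rule R(1))
  show "inj F" unfolding F_def by (rule R(2))
qed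

section \<open>Discriminant of a cubic (coefficients in ascending order) and of a pencil\<close>

definition cubic_disc :: "'a::comm_ring_1 \<Rightarrow> 'a \<Rightarrow> 'a \<Rightarrow> 'a \<Rightarrow> 'a" where
  "cubic_disc c0 c1 c2 c3 =
     18 * c0 * c1 * c2 * c3 - 4 * c2 ^ 3 * c0 + c1 ^ 2 * c2 ^ 2 - 4 * c3 * c1 ^ 3 - 27 * c0 ^ 2 * c3 ^ 2"

text \<open>Take a root \<open>u\<close>, then a root \<open>v\<close> of the quadratic quotient by
  \<open>x - u\<close>; the third root \<open>w\<close> comes from the sum of the roots. In terms of
  these roots the discriminant is \<open>c3 ^ 4\<close> times the squared product of their
  differences.\<close>

lemma three_roots_of_cubic_disc:
  fixes c0 c1 c2 c3 :: complex
  assumes "c3 \<noteq> 0" "cubic_disc c0 c1 c2 c3 \<noteq> 0"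
  obtains lam :: "3 \<Rightarrow> complex" where "inj lam" "\<And>i. c0 + c1 * lam i + c2 * lam i ^ 2 + c3 * lam i ^ 3 = 0"
proof -
  obtain u where "poly [:c0, c1, c2, c3:] u = 0"
    using alg_closed_imp_poly_has_root[of "[:c0, c1, c2, c3:]"] assms(1) by auto
  then have u: "c0 = - (c1 * u + c2 * u ^ 2 + c3 * u ^ 3)"
    by (simp add: algebra_simps power2_eq_square power3_eq_cube eq_neg_iff_add_eq_0)
  obtain v where "poly [:c1 + c2 * u + c3 * u ^ 2, c2 + c3 * u, c3:] v = 0"
    using alg_closed_imp_poly_has_root[of "[:c1 + c2 * u + c3 * u ^ 2, c2 + c3 * u, c3:]"] assms(1) by auto
  then have v: "c1 = - (c2 * u + c3 * u ^ 2 + c2 * v + c3 * u * v + c3 * v ^ 2)"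
    by (simp add: algebra_simps power2_eq_square eq_neg_iff_add_eq_0)
  define w where "w = - (c2 / c3 + u + v)"
  have w: "c2 = - c3 * (u + v + w)"
    using assms(1) by (simp add: w_def field_simps)
  have c1: "c1 = c3 * (u * v + u * w + v * w)" unfolding v w by algebra
  have c0: "c0 = - c3 * u * v * w" unfolding u c1 w by algebra
  have "cubic_disc c0 c1 c2 c3 = c3 ^ 4 * ((u - v) * (u - w) * (v - w)) ^ 2"
    unfolding cubic_disc_def c0 c1 w by algebra
  with assms(2) have ne: "u \<noteq> v" "u \<noteq> w" "v \<noteq> w" by auto
  show thesis
  proof
    let ?l = "\<lambda>i::3. if i = 1 then u else if i = 2 then v else w"
    show "inj ?l" using ne by (simp add: inj_def forall_3)
    have "c0 + c1 * x + c2 * x ^ 2 + c3 * x ^ 3 = c3 * (x - u) * (x - v) * (x - w)" for x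
      unfolding c0 c1 w by algebra
    then show "c0 + c1 * ?l i + c2 * ?l i ^ 2 + c3 * ?l i ^ 3 = 0" for i
      by simp
  qed
qed

text \<open>The middle coefficients are recovered from the values at 1 and -1. Written through
  determinants, they are visibly polynomial in the entries.\<close>

lemma det_pencil_cubic:
  fixes W W' :: "'a::field_char_0 ^ 3 ^ 3"
  shows "det (\<chi> h j. W $ h $ j - x * W' $ h $ j) =
    det W + ((det (W - W') - det (W + W')) / 2 + det W') * x
      + ((det (W - W') + det (W + W')) / 2 - det W) * x ^ 2 + (- det W') * x ^ 3"
  unfolding det_3 by (simp add: field_simps power2_eq_square power3_eq_cube)

text \<open>By \<open>det_pencil_cubic\<close>, the discriminant in \<open>x\<close> of
  \<open>det (W - x W')\<close>.\<close>

definition pencil_disc :: "'a::field ^ 3 ^ 3 \<Rightarrow> 'a ^ 3 ^ 3 \<Rightarrow> 'a" where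
  "pencil_disc W W' = cubic_disc (det W) ((det (W - W') - det (W + W')) / 2 + det W')
     ((det (W - W') + det (W + W')) / 2 - det W) (- det W')"

text \<open>The three distinct roots of the determinant are eigenvalues of the pencil; each singular
  matrix supplies a row eigenvector for \<open>transversals_pencil\<close>.\<close>

lemma card_transversals:
  fixes a b :: "3 \<Rightarrow> complex ^ 'n" and W W' :: "complex ^ 3 ^ 3"
  assumes ind: "\<And>x y. (\<Sum>i\<in>UNIV. x i *s a i) + (\<Sum>i\<in>UNIV. y i *s b i) = 0 \<Longrightarrow> \<forall>i. x i = 0 \<and> y i = 0"
    and W: "det W \<noteq> 0" "det W' \<noteq> 0" "pencil_disc W W' \<noteq> 0" and pr: "p \<noteq> 0" "r \<noteq> 0"
    and sub: "vec.subspace A" "vec.subspace B" "vec.subspace C" "vec.subspace D"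
    and dims: "vec.dim A \<le> 3" "vec.dim B \<le> 3" "vec.dim C \<le> 3" "vec.dim D \<le> 3"
    and mem: "\<And>h. a h \<in> A" "\<And>h. b h \<in> B" "\<And>h. p *s a h + (\<Sum>j\<in>UNIV. W $ h $ j *s b j) \<in> C"
      "\<And>h. r *s a h + (\<Sum>j\<in>UNIV. W' $ h $ j *s b j) \<in> D"
  defines "S \<equiv> {X. vec.subspace X \<and> vec.dim X = 2 \<and> (\<forall>Y\<in>{A, B, C, D}. 1 \<le> vec.dim (X \<inter> Y))}"
  shows "finite S" "card S = 3"
proof -
  have "- det W' \<noteq> 0" using W(2) by simp
  then obtain lam :: "3 \<Rightarrow> complex" where lam: "inj lam"
    and root: "\<And>i. det (\<chi> h j. W $ h $ j - lam i * W' $ h $ j) = 0"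
    using three_roots_of_cubic_disc[OF _ W(3)[unfolded pencil_disc_def]] unfolding det_pencil_cubic
    by blast
  have "\<exists>c. (\<forall>j. (\<Sum>h\<in>UNIV. c h * (W $ h $ j - lam i * W' $ h $ j)) = 0) \<and> (\<exists>h. c h \<noteq> 0)" for i
    using root[of i] det_nonzero_iff_rows[of "\<chi> h j. W $ h $ j - lam i * W' $ h $ j"] by auto
  then have "\<forall>i. \<exists>c. (\<forall>j. (\<Sum>h\<in>UNIV. c h * (W $ h $ j - lam i * W' $ h $ j)) = 0) \<and> (\<exists>h. c h \<noteq> 0)"
    by blast
  from choice[OF this] obtain z where z: "\<And>i. \<exists>h. z i h \<noteq> 0"
    and eig: "\<And>i j. (\<Sum>h\<in>UNIV. z i h * (W $ h $ j - lam i * W' $ h $ j)) = 0"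
    by blast
  have eig': "(\<Sum>h\<in>UNIV. z i h * W $ h $ j) = lam i * (\<Sum>h\<in>UNIV. z i h * W' $ h $ j)" for i j
    using eig[where i = i and j = j] by (simp add: sum_3 algebra_simps)
  note R = transversals_pencil[OF ind W(1,2) lam pr z eig' sub dims mem]
  show "finite S" unfolding S_def by (subst R(1), assumption, rule finite_imageI[OF finite])
  show "card S = 3" unfolding S_def by (subst R(1), assumption, subst card_image[OF R(2)], assumption) simp
qed

section \<open>Polynomial functions\<close>

text \<open>Unlike \<open>nonzero_poly_fun\<close>, this admits zero coefficients and repeated exponents, so that
  it is closed under the ring operations.\<close>
definition poly_fun :: "(('v::finite \<Rightarrow> 'a::comm_ring_1) \<Rightarrow> 'a) \<Rightarrow> bool" where
  "poly_fun f \<longleftrightarrow> (\<exists>L. f = (\<lambda>x. \<Sum>(c, e)\<leftarrow>L. c * (\<Prod>v\<in>UNIV. x v ^ e v)))"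

lemma poly_fun_const: "poly_fun (\<lambda>x. c)"
  unfolding poly_fun_def by (rule exI[of _ "[(c, \<lambda>_. 0)]"]) simp

lemma poly_fun_var: "poly_fun (\<lambda>x. x v)"
  unfolding poly_fun_def
  by (rule exI[of _ "[(1, \<lambda>w. if w = v then 1 else 0)]"]) (simp add: if_distrib[of "power _"] cong: if_cong)

lemma poly_fun_add:
  assumes "poly_fun f" "poly_fun g"
  shows "poly_fun (\<lambda>x. f x + g x)"
proof -
  obtain L L' where "f = (\<lambda>x. \<Sum>(c, e)\<leftarrow>L. c * (\<Prod>v\<in>UNIV. x v ^ e v))"
    "g = (\<lambda>x. \<Sum>(c, e)\<leftarrow>L'. c * (\<Prod>v\<in>UNIV. x v ^ e v))"
    using assms unfolding poly_fun_def by blast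
  then show ?thesis
    unfolding poly_fun_def by (intro exI[of _ "L @ L'"]) simp
qed

lemma poly_fun_mult:
  assumes "poly_fun f" "poly_fun g"
  shows "poly_fun (\<lambda>x. f x * g x)"
proof -
  obtain L L' where f: "f = (\<lambda>x. \<Sum>(c, e)\<leftarrow>L. c * (\<Prod>v\<in>UNIV. x v ^ e v))"
    and g: "g = (\<lambda>x. \<Sum>(c, e)\<leftarrow>L'. c * (\<Prod>v\<in>UNIV. x v ^ e v))"
    using assms unfolding poly_fun_def by blast
  have "poly_fun (\<lambda>x. (\<Sum>(c, e)\<leftarrow>L. c * (\<Prod>v\<in>UNIV. x v ^ e v)) * g x)"
  proof (induction L)
    case Nil
    show ?case using poly_fun_const[of 0] by simp
  next
    case (Cons a L)
    obtain c e where a: "a = (c, e)" by (cases a)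
    \<comment> \<open>Multiplication by one monomial acts on a list of terms entry by entry.\<close>
    have "c * (\<Prod>v\<in>UNIV. x v ^ e v) * (\<Sum>(c, e)\<leftarrow>K. c * (\<Prod>v\<in>UNIV. x v ^ e v)) =
       (\<Sum>(c, e)\<leftarrow>map (\<lambda>(c', e'). (c * c', \<lambda>v. e v + e' v)) K. c * (\<Prod>v\<in>UNIV. x v ^ e v))" for x K
      by (induction K) (auto simp: algebra_simps power_add prod.distrib)
    then have "poly_fun (\<lambda>x. c * (\<Prod>v\<in>UNIV. x v ^ e v) * g x)"
      unfolding poly_fun_def g by blast
    from poly_fun_add[OF this Cons.IH] show ?case by (simp add: a distrib_right)
  qed
  then show ?thesis by (simp add: f)
qed

lemma poly_fun_uminus: "poly_fun f \<Longrightarrow> poly_fun (\<lambda>x. - f x)"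
  using poly_fun_mult[OF poly_fun_const[of "-1"], of f] by simp

lemma poly_fun_diff: "poly_fun f \<Longrightarrow> poly_fun g \<Longrightarrow> poly_fun (\<lambda>x. f x - g x)"
  using poly_fun_add[OF _ poly_fun_uminus, of f g] by simp

lemma poly_fun_power: "poly_fun f \<Longrightarrow> poly_fun (\<lambda>x. f x ^ n)"
  by (induction n) (auto intro: poly_fun_const poly_fun_mult)

lemma poly_fun_sum: "(\<And>i. i \<in> I \<Longrightarrow> poly_fun (f i)) \<Longrightarrow> poly_fun (\<lambda>x. \<Sum>i\<in>I. f i x)"
  by (induction I rule: infinite_finite_induct) (auto intro: poly_fun_const poly_fun_add)

lemma poly_fun_prod: "(\<And>i. i \<in> I \<Longrightarrow> poly_fun (f i)) \<Longrightarrow> poly_fun (\<lambda>x. \<Prod>i\<in>I. f i x)"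
  by (induction I rule: infinite_finite_induct) (auto intro: poly_fun_const poly_fun_mult)

lemma poly_fun_det: "(\<And>i j. poly_fun (\<lambda>x. A x $ i $ j)) \<Longrightarrow> poly_fun (\<lambda>x. det (A x))"
  unfolding det_def by (intro poly_fun_sum poly_fun_mult poly_fun_const poly_fun_prod)

lemmas poly_fun_intros = poly_fun_const poly_fun_var poly_fun_add poly_fun_mult poly_fun_uminus
  poly_fun_diff poly_fun_power poly_fun_det

text \<open>Terms with equal exponents are merged and zero coefficients are dropped. The nonzero
  value at \<open>x0\<close> guarantees that some exponent remains.\<close>

lemma poly_fun_imp_nonzero_poly_fun:
  assumes "poly_fun f" "f x0 \<noteq> 0"
  shows "nonzero_poly_fun f"
proof -
  obtain L where f: "f = (\<lambda>x. \<Sum>(c, e)\<leftarrow>L. c * (\<Prod>v\<in>UNIV. x v ^ e v))"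
    using assms unfolding poly_fun_def by blast
  have "\<exists>E c. finite E \<and> (\<forall>x. (\<Sum>(c, e)\<leftarrow>L. c * (\<Prod>v\<in>UNIV. x v ^ e v)) = (\<Sum>e\<in>E. c e * (\<Prod>v\<in>UNIV. x v ^ e v)))"
  proof (induction L)
    case Nil
    show ?case by (rule exI[of _ "{}"]) simp
  next
    case (Cons a L)
    obtain c0 e0 where a: "a = (c0, e0)" by (cases a)
    from Cons.IH obtain E c where E: "finite E"
      and c: "\<And>x. (\<Sum>(c, e)\<leftarrow>L. c * (\<Prod>v\<in>UNIV. x v ^ e v)) = (\<Sum>e\<in>E. c e * (\<Prod>v\<in>UNIV. x v ^ e v))"
      by blast
    \<comment> \<open>The values of \<open>c\<close> outside \<open>E\<close> are arbitrary, hence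
      the guard on the second summand.\<close>
    let ?c = "\<lambda>e. (if e = e0 then c0 else 0) + (if e \<in> E then c e else 0)"
    have "(\<Sum>e\<in>insert e0 E. ?c e * m e) = c0 * m e0 + (\<Sum>e\<in>E. c e * m e)" for m
    proof -
      have "(\<Sum>e\<in>insert e0 E. (if e = e0 then c0 else 0) * m e) = c0 * m e0"
        using E by (simp add: if_distrib[of "\<lambda>c. c * _"] cong: if_cong)
      moreover have "(\<Sum>e\<in>insert e0 E. (if e \<in> E then c e else 0) * m e) = (\<Sum>e\<in>E. c e * m e)"
        using E by (intro sum.mono_neutral_cong_right) auto
      ultimately show ?thesis by (simp add: distrib_right sum.distrib)
    qed
    then show ?case
      by (intro exI[of _ "insert e0 E"] exI[of _ ?c]) (simp add: a c E)
  qed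
  then obtain E c where E: "finite E" and f': "\<And>x. f x = (\<Sum>e\<in>E. c e * (\<Prod>v\<in>UNIV. x v ^ e v))"
    unfolding f by blast
  have f'': "f x = (\<Sum>e\<in>{e\<in>E. c e \<noteq> 0}. c e * (\<Prod>v\<in>UNIV. x v ^ e v))" for x
    unfolding f' using E by (intro sum.mono_neutral_right) auto
  have "{e\<in>E. c e \<noteq> 0} \<noteq> {}" using f''[of x0] assms(2) by (metis sum.empty)
  moreover have "f = (\<lambda>x. \<Sum>e\<in>{e\<in>E. c e \<noteq> 0}. c e * (\<Prod>v\<in>UNIV. x v ^ e v))"
    by (rule ext) (rule f'')
  ultimately show ?thesis
    unfolding nonzero_poly_fun_def using E by (intro exI[of _ "{e\<in>E. c e \<noteq> 0}"] exI[of _ c]) simp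
qed

section \<open>General flags\<close>

lemma UNIV_6: "(UNIV :: 6 set) = {0, 1, 2, 3, 4, 5}"
  by (rule sym, rule card_subset_eq) auto

lemma sum_6: "(\<Sum>i\<in>UNIV. f i) = f 0 + f 1 + f 2 + f 3 + f 4 + f (5 :: 6)"
  unfolding UNIV_6 by (simp add: add.assoc)

lemma forall_6: "(\<forall>i. P i) \<longleftrightarrow> P 0 \<and> P 1 \<and> P 2 \<and> P 3 \<and> P 4 \<and> P (5 :: 6)"
proof -
  have "(\<forall>i. P i) \<longleftrightarrow> (\<forall>i\<in>(UNIV :: 6 set). P i)" by simp
  then show ?thesis unfolding UNIV_6 by simp
qed

lemma idx_6: "idx (0::6) = 0" "idx (1::6) = 1" "idx (2::6) = 2" "idx (3::6) = 3" "idx (4::6) = 4" "idx (5::6) = 5"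
  by (simp_all add: idx_def bit0.Rep_numeral bit0.Rep_0 bit0.Rep_1)

text \<open>The positions of the rows spanning \<open>K_3\<close>. Type \<open>3\<close> is run
  through as 1, 2, 3, whereas the positions in type \<open>6\<close> run from 0 to 5.\<close>

definition low :: "3 \<Rightarrow> 6" where
  "low h = (if h = 1 then 0 else if h = 2 then 1 else 2)"

definition stack :: "(3 \<Rightarrow> 'a) \<Rightarrow> (3 \<Rightarrow> 'a) \<Rightarrow> 6 \<Rightarrow> 'a" where
  "stack a b i = (if i = 0 then a 1 else if i = 1 then a 2 else if i = 2 then a 3
     else if i = 3 then b 1 else if i = 4 then b 2 else b 3)"

lemma stack_simps [simp]: "stack a b 0 = a 1" "stack a b 1 = a 2" "stack a b 2 = a 3"
  "stack a b 3 = b 1" "stack a b 4 = b 2" "stack a b 5 = b 3"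
  by (simp_all add: stack_def)

lemma stack_surj: obtains x y where "c = stack x y"
proof
  show "c = stack (\<lambda>h. if h = 1 then c 0 else if h = 2 then c 1 else c 2)
     (\<lambda>h. if h = 1 then c 3 else if h = 2 then c 4 else c 5)" (is "_ = ?r")
  proof -
    have "\<forall>i. c i = ?r i" unfolding forall_6 by simp
    then show ?thesis by auto
  qed
qed

lemma forall_stack:
  fixes P :: "(6 \<Rightarrow> 'a) \<Rightarrow> bool"
  shows "(\<forall>c. P c) \<longleftrightarrow> (\<forall>x y. P (stack x y))"
proof (intro iffI allI)
  fix c :: "6 \<Rightarrow> 'a" assume P: "\<forall>x y. P (stack x y)"
  obtain x y where "c = stack x y" by (rule stack_surj)
  with P show "P c" by simp
qed simp

lemma sum_stack:
  fixes a b :: "3 \<Rightarrow> 'a::field ^ 'n"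
  shows "(\<Sum>i\<in>UNIV. stack x y i *s stack a b i) = (\<Sum>i\<in>UNIV. x i *s a i) + (\<Sum>i\<in>UNIV. y i *s b i)"
  by (simp add: sum_6 sum_3 add.assoc)

lemma det_stack_nonzero_iff:
  fixes a b :: "3 \<Rightarrow> 'a::field ^ 6"
  shows "det (\<chi> i. stack a b i) \<noteq> 0 \<longleftrightarrow>
    (\<forall>x y. (\<Sum>i\<in>UNIV. x i *s a i) + (\<Sum>i\<in>UNIV. y i *s b i) = 0 \<longrightarrow> (\<forall>i. x i = 0 \<and> y i = 0))"
    (is "_ \<longleftrightarrow> ?R")
proof -
  have "det (\<chi> i. stack a b i) \<noteq> 0 \<longleftrightarrow> (\<forall>c. (\<Sum>i\<in>UNIV. c i *s stack a b i) = 0 \<longrightarrow> (\<forall>i. c i = 0))"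
    by (simp add: det_nonzero_iff_rows vec_eq_iff)
  also have "\<dots> \<longleftrightarrow> (\<forall>x y. (\<Sum>i\<in>UNIV. stack x y i *s stack a b i) = 0 \<longrightarrow> (\<forall>i. stack x y i = 0))"
    by (rule forall_stack)
  also have "\<dots> \<longleftrightarrow> ?R"
    unfolding sum_stack forall_6 stack_simps forall_3 by blast
  finally show ?thesis .
qed

lemma stack_independent:
  fixes a b :: "3 \<Rightarrow> 'a::field ^ 6"
  assumes "det (\<chi> i. stack a b i) \<noteq> 0" "(\<Sum>i\<in>UNIV. x i *s a i) + (\<Sum>i\<in>UNIV. y i *s b i) = 0"
  shows "x i = 0 \<and> y i = 0"
  using assms unfolding det_stack_nonzero_iff by blast

text \<open>Keeping \<open>det M\<close> on the left avoids denominators, so the coefficients stay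
  polynomial in the entries of \<open>M\<close> and \<open>v\<close>.\<close>

lemma cramer_rows:
  fixes M :: "'a::field ^ 'n ^ 'n"
  assumes "det M \<noteq> 0"
  shows "det M *s v = (\<Sum>k\<in>UNIV. det (\<chi> i. if i = k then v else M $ i) *s M $ k)"
proof -
  have row: "row i M = M $ i" for i by (simp add: row_def)
  have ind: "\<forall>i. x i = 0" if "(\<Sum>i\<in>UNIV. x i *s M $ i) = 0" for x
    using assms that unfolding det_nonzero_iff_rows by (simp add: vec_eq_iff)
  have "vec.dim (UNIV :: ('a ^ 'n) set) \<le> CARD('n)" by (simp add: card_cart_basis)
  then obtain x where v: "v = (\<Sum>i\<in>UNIV. x i *s M $ i)"
    using subspace_eq_combinations[where v = "($) M" and U = UNIV and w = v, OF ind] by auto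
  have "det (\<chi> i. if i = k then v else M $ i) = x k * det M" for k
    using cramer_lemma_transpose[of k "vec_lambda x" M] unfolding row v vec_lambda_beta .
  moreover have "det M *s v = (\<Sum>k\<in>UNIV. (x k * det M) *s M $ k)"
    unfolding v vec.scale_sum_right vec.scale_scale by (simp only: mult.commute)
  ultimately show ?thesis by simp
qed

text \<open>Cramer's rule writes \<open>a h\<close> in terms of \<open>b\<close> and \<open>c\<close>; moving the \<open>b\<close>-part to the left gives
  polynomial coordinates for a basis of the span of \<open>c\<close>.\<close>
definition graph_matrix :: "(3 \<Rightarrow> 'a::field ^ 6) \<Rightarrow> (3 \<Rightarrow> 'a ^ 6) \<Rightarrow> (3 \<Rightarrow> 'a ^ 6) \<Rightarrow> 'a ^ 3 ^ 3" where
  "graph_matrix a b c = (\<chi> h j. - det (\<chi> i. stack (b(j := a h)) c i))"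

lemma graph_matrix_cramer:
  assumes "det (\<chi> i. stack b c i) \<noteq> 0"
  obtains y where "det (\<chi> i. stack b c i) *s a h + (\<Sum>j\<in>UNIV. graph_matrix a b c $ h $ j *s b j)
    = (\<Sum>j\<in>UNIV. y j *s c j)"
proof
  let ?M = "\<chi> i. stack b c i"
  let ?d = "\<lambda>k. det (\<chi> i. if i = k then a h else ?M $ i)"
  \<comment> \<open>Rows 0, 1, 2 of the stacked matrix are the members 1, 2, 3 of \<open>b\<close>,
    so these Cramer determinants are the entries of \<open>graph_matrix\<close> up to sign.\<close>
  have up: "(\<chi> i. if i = (0::6) then a h else ?M $ i) = (\<chi> i. stack (b(1 := a h)) c i)"
    "(\<chi> i. if i = (1::6) then a h else ?M $ i) = (\<chi> i. stack (b(2 := a h)) c i)"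
    "(\<chi> i. if i = (2::6) then a h else ?M $ i) = (\<chi> i. stack (b(3 := a h)) c i)"
    by (simp_all add: vec_eq_iff[where 'b = 6] forall_6)
  have "?d = stack (\<lambda>j. if j = 1 then ?d 0 else if j = 2 then ?d 1 else ?d 2)
      (\<lambda>j. if j = 1 then ?d 3 else if j = 2 then ?d 4 else ?d 5)" (is "_ = stack ?x ?y")
  proof -
    have "\<forall>i. ?d i = stack ?x ?y i" unfolding forall_6 by simp
    then show ?thesis by auto
  qed
  have x: "?x j = - graph_matrix a b c $ h $ j" for j
    unfolding graph_matrix_def up using exhaust_3[of j] by auto
  have "det ?M *s a h = (\<Sum>k\<in>UNIV. stack ?x ?y k *s stack b c k)"
    using cramer_rows[OF assms, of "a h"] by (simp add: sum_6)
  also have "\<dots> = - (\<Sum>j\<in>UNIV. graph_matrix a b c $ h $ j *s b j) + (\<Sum>j\<in>UNIV. ?y j *s c j)"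
    unfolding sum_stack x by (simp add: sum_negf)
  finally show "det ?M *s a h + (\<Sum>j\<in>UNIV. graph_matrix a b c $ h $ j *s b j) = (\<Sum>j\<in>UNIV. ?y j *s c j)"
    by simp
qed

text \<open>The product of all genericity conditions: the spans of \<open>a\<close> and
  \<open>b\<close> are complementary, those of \<open>c\<close> and \<open>d\<close> are graphs over
  the span of \<open>a\<close>, both graph maps are invertible, and the eigenvalues of the pencil
  are distinct.\<close>

definition transversal_disc :: "(3 \<Rightarrow> 'a::field ^ 6) \<Rightarrow> (3 \<Rightarrow> 'a ^ 6) \<Rightarrow> (3 \<Rightarrow> 'a ^ 6) \<Rightarrow> (3 \<Rightarrow> 'a ^ 6) \<Rightarrow> 'a" where
  "transversal_disc a b c d =
     det (\<chi> i. stack a b i) * det (\<chi> i. stack b c i) * det (\<chi> i. stack b d i)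
     * det (graph_matrix a b c) * det (graph_matrix a b d)
     * pencil_disc (graph_matrix a b c) (graph_matrix a b d)"

lemma dim_span_range_le: "vec.dim (vec.span (range (f :: 3 \<Rightarrow> 'a::field ^ 'n))) \<le> 3"
proof -
  have "vec.dim (range f) \<le> card (range f)" by (simp add: vec.dim_le_card')
  also have "\<dots> \<le> CARD(3)" by (rule card_image_le) simp
  finally show ?thesis by simp
qed

lemma card_transversals_span:
  fixes a b c d :: "3 \<Rightarrow> complex ^ 6"
  assumes "transversal_disc a b c d \<noteq> 0"
  defines "S \<equiv> {X. vec.subspace X \<and> vec.dim X = 2 \<and>
    (\<forall>Y\<in>{vec.span (range a), vec.span (range b), vec.span (range c), vec.span (range d)}. 1 \<le> vec.dim (X \<inter> Y))}"
  shows "finite S" "card S = 3"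
proof -
  have nz: "det (\<chi> i. stack a b i) \<noteq> 0" "det (\<chi> i. stack b c i) \<noteq> 0" "det (\<chi> i. stack b d i) \<noteq> 0"
    "det (graph_matrix a b c) \<noteq> 0" "det (graph_matrix a b d) \<noteq> 0"
    "pencil_disc (graph_matrix a b c) (graph_matrix a b d) \<noteq> 0"
    using assms(1) unfolding transversal_disc_def by auto
  have ind: "\<forall>i. x i = 0 \<and> y i = 0" if "(\<Sum>i\<in>UNIV. x i *s a i) + (\<Sum>i\<in>UNIV. y i *s b i) = 0" for x y
    using nz(1) that unfolding det_stack_nonzero_iff by blast
  have mem: "det (\<chi> i. stack b e i) *s a h + (\<Sum>j\<in>UNIV. graph_matrix a b e $ h $ j *s b j) \<in> vec.span (range e)"
    if e: "det (\<chi> i. stack b e i) \<noteq> 0" for e h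
  proof -
    obtain y where y: "det (\<chi> i. stack b e i) *s a h + (\<Sum>j\<in>UNIV. graph_matrix a b e $ h $ j *s b j)
        = (\<Sum>j\<in>UNIV. y j *s e j)"
      by (rule graph_matrix_cramer[OF e])
    show ?thesis unfolding y span_range_eq by (rule rangeI)
  qed
  have ab: "a h \<in> vec.span (range a)" "b h \<in> vec.span (range b)" for h
    by (simp_all add: vec.span_base)
  note R = card_transversals[OF ind nz(4,5,6,2,3) vec.subspace_span vec.subspace_span
      vec.subspace_span vec.subspace_span dim_span_range_le dim_span_range_le dim_span_range_le
      dim_span_range_le ab mem[OF nz(2)] mem[OF nz(3)]]
  show "finite S" unfolding S_def by (rule R(1))
  show "card S = 3" unfolding S_def by (rule R(2))
qed

lemma poly_fun_transversal_disc:
  fixes a b c d :: "('v::finite \<Rightarrow> 'a::field) \<Rightarrow> 3 \<Rightarrow> 'a ^ 6"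
  assumes "\<And>h j. poly_fun (\<lambda>x. a x h $ j)" "\<And>h j. poly_fun (\<lambda>x. b x h $ j)"
    "\<And>h j. poly_fun (\<lambda>x. c x h $ j)" "\<And>h j. poly_fun (\<lambda>x. d x h $ j)"
  shows "poly_fun (\<lambda>x. transversal_disc (a x) (b x) (c x) (d x))"
proof -
  have st: "poly_fun (\<lambda>x. det (\<chi> i. stack (f x) (g x) i))"
    if "\<And>h j. poly_fun (\<lambda>x. f x h $ j)" "\<And>h j. poly_fun (\<lambda>x. g x h $ j)"
    for f g :: "('v \<Rightarrow> 'a) \<Rightarrow> 3 \<Rightarrow> 'a ^ 6"
  proof (rule poly_fun_det)
    fix i j
    have "\<forall>i. poly_fun (\<lambda>x. stack (f x) (g x) i $ j)"
      unfolding forall_6 using that by simp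
    then show "poly_fun (\<lambda>x. (\<chi> i. stack (f x) (g x) i) $ i $ j)" by simp
  qed
  have gm: "poly_fun (\<lambda>x. graph_matrix (a x) (b x) (f x) $ h $ j)"
    if "\<And>h j. poly_fun (\<lambda>x. f x h $ j)" for f h j
    unfolding graph_matrix_def vec_lambda_beta
  proof (intro poly_fun_uminus st)
    show "poly_fun (\<lambda>x. ((b x)(j := a x h)) h' $ j')" for h' j'
      using assms by (cases "h' = j") simp_all
  qed (rule that)
  have half: "poly_fun (\<lambda>x. f x / 2)" if "poly_fun f" for f :: "('v \<Rightarrow> 'a) \<Rightarrow> 'a"
    using poly_fun_mult[OF poly_fun_const[of "1/2"] that] by simp
  show ?thesis
    unfolding transversal_disc_def pencil_disc_def cubic_disc_def
    by (intro poly_fun_intros half st assms) (simp_all add: gm assms poly_fun_add poly_fun_diff)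
qed

section \<open>A configuration with nonzero discriminant\<close>

lemma stack_add_scaled_independent:
  fixes a b :: "3 \<Rightarrow> 'a::field ^ 6"
  assumes "det (\<chi> i. stack a b i) \<noteq> 0"
  shows "det (\<chi> i. stack b (\<lambda>h. a h + l h *s b h) i) \<noteq> 0"
  unfolding det_stack_nonzero_iff
proof (intro allI impI)
  fix x y i assume "(\<Sum>i\<in>UNIV. x i *s b i) + (\<Sum>i\<in>UNIV. y i *s (a i + l i *s b i)) = 0"
  then have "(\<Sum>i\<in>UNIV. y i *s a i) + (\<Sum>i\<in>UNIV. (x i + y i * l i) *s b i) = 0"
    by (simp add: vec.scale_right_distrib vec.scale_left_distrib sum.distrib add_ac)
  from stack_independent[OF assms this, of i] show "x i = 0 \<and> y i = 0" by auto
qed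

text \<open>Since \<open>a h + l h *s b h\<close> is \<open>c h\<close>, the graph map is diagonal;
  the factor is the determinant cleared by Cramer's rule. The entries follow by comparing
  coordinates in the basis \<open>a\<close>, \<open>b\<close>.\<close>

lemma graph_matrix_add_scaled:
  fixes a b :: "3 \<Rightarrow> 'a::field ^ 6" and l :: "3 \<Rightarrow> 'a"
  assumes "det (\<chi> i. stack a b i) \<noteq> 0"
  defines "c \<equiv> \<lambda>h. a h + l h *s b h"
  shows "graph_matrix a b c $ h $ j = (if h = j then det (\<chi> i. stack b c i) * l h else 0)"
proof -
  have "det (\<chi> i. stack b c i) \<noteq> 0"
    unfolding c_def by (rule stack_add_scaled_independent[OF assms(1)])
  then obtain y where y: "det (\<chi> i. stack b c i) *s a h + (\<Sum>j\<in>UNIV. graph_matrix a b c $ h $ j *s b j)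
    = (\<Sum>j\<in>UNIV. y j *s c j)"
    by (rule graph_matrix_cramer)
  let ?p = "det (\<chi> i. stack b c i)"
  let ?x = "\<lambda>j. (if j = h then ?p else 0) - y j" and ?z = "\<lambda>j. graph_matrix a b c $ h $ j - y j * l j"
  have "(\<Sum>j\<in>UNIV. (if j = h then ?p else 0) *s a j) = ?p *s a h"
    by (simp add: if_distrib[of "\<lambda>c. c *s _"] cong: if_cong)
  moreover have "(\<Sum>j\<in>UNIV. y j *s c j) = (\<Sum>j\<in>UNIV. y j *s a j) + (\<Sum>j\<in>UNIV. (y j * l j) *s b j)"
    unfolding c_def by (simp add: vec.scale_right_distrib sum.distrib)
  ultimately have "(\<Sum>j\<in>UNIV. ?x j *s a j) + (\<Sum>j\<in>UNIV. ?z j *s b j) = 0"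
    using y by (simp add: vec.scale_left_diff_distrib sum_subtractf) (simp add: algebra_simps)
  from stack_independent[OF assms(1) this, of j] have "?x j = 0" "?z j = 0" by blast+
  then show ?thesis by (auto split: if_splits)
qed

text \<open>Both graph matrices are diagonal, \<open>p\<close> times the identity and
  \<open>r\<close> times \<open>l\<close>, so the pencil has the distinct eigenvalues
  \<open>p / (r * l h)\<close>.\<close>

lemma transversal_disc_nonzero:
  fixes a b :: "3 \<Rightarrow> 'a::field_char_0 ^ 6"
  assumes "det (\<chi> i. stack a b i) \<noteq> 0" and l: "inj l" "\<And>h. l h \<noteq> 0"
  shows "transversal_disc a b (\<lambda>h. a h + b h) (\<lambda>h. a h + l h *s b h) \<noteq> 0"
proof -
  let ?c = "\<lambda>h. a h + 1 *s b h" and ?d = "\<lambda>h. a h + l h *s b h"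
  define p where "p = det (\<chi> i. stack b ?c i)"
  define r where "r = det (\<chi> i. stack b ?d i)"
  have p: "p \<noteq> 0" unfolding p_def by (rule stack_add_scaled_independent[OF assms(1)])
  have r: "r \<noteq> 0" unfolding r_def by (rule stack_add_scaled_independent[OF assms(1)])
  have W: "graph_matrix a b ?c $ h $ j = (if h = j then p else 0)" for h j
    unfolding p_def using graph_matrix_add_scaled[OF assms(1), of "\<lambda>_. 1" h j] by simp
  have W': "graph_matrix a b ?d $ h $ j = (if h = j then r * l h else 0)" for h j
    unfolding r_def by (rule graph_matrix_add_scaled[OF assms(1), of l h j])
  have dW: "det (graph_matrix a b ?c) = p ^ 3"
    unfolding det_3 W by (simp add: power3_eq_cube)
  have dW': "det (graph_matrix a b ?d) = r ^ 3 * (l 1 * l 2 * l 3)"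
    unfolding det_3 W' by (simp add: power3_eq_cube)
  \<comment> \<open>\<open>c1\<close> and \<open>c2\<close> are the coefficients of \<open>x\<close>
    and \<open>x ^ 2\<close> in the product of the factors \<open>p - x * r * l h\<close>.\<close>
  have c1: "(det (graph_matrix a b ?c - graph_matrix a b ?d) - det (graph_matrix a b ?c + graph_matrix a b ?d)) / 2
      + r ^ 3 * (l 1 * l 2 * l 3) = - (p ^ 2 * r * (l 1 + l 2 + l 3))"
    unfolding det_3 vector_minus_component vector_add_component W W'
    by (simp add: field_simps power3_eq_cube power2_eq_square)
  have c2: "(det (graph_matrix a b ?c - graph_matrix a b ?d) + det (graph_matrix a b ?c + graph_matrix a b ?d)) / 2
      - p ^ 3 = p * r ^ 2 * (l 1 * l 2 + l 1 * l 3 + l 2 * l 3)"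
    unfolding det_3 vector_minus_component vector_add_component W W'
    by (simp add: field_simps power3_eq_cube power2_eq_square)
  have "pencil_disc (graph_matrix a b ?c) (graph_matrix a b ?d)
      = (p * r) ^ 6 * ((l 1 - l 2) * (l 1 - l 3) * (l 2 - l 3)) ^ 2"
    unfolding pencil_disc_def dW dW' c1 c2 cubic_disc_def by algebra
  moreover have "l 1 \<noteq> l 2" "l 1 \<noteq> l 3" "l 2 \<noteq> l 3" using l(1) by (simp_all add: inj_eq)
  ultimately have "transversal_disc a b ?c ?d \<noteq> 0"
    unfolding transversal_disc_def dW dW' p_def[symmetric] r_def[symmetric] using p r l(2) assms(1) by simp
  then show ?thesis by simp
qed

section \<open>The Schubert condition \<open>J 2 2\<close> and the generic count\<close>

lemma idx_less_3_iff: "idx r < 3 \<longleftrightarrow> r \<in> range low"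
proof -
  have "range low = {0, 1, 2}" unfolding UNIV_3 by (auto simp: low_def)
  moreover have "\<forall>r::6. idx r < 3 \<longleftrightarrow> r \<in> {0, 1, 2}" unfolding forall_6 by (simp add: idx_6)
  ultimately show ?thesis by simp
qed

lemma span_rows_UNIV:
  fixes M :: "'a::field ^ 'n ^ 'n"
  assumes "det M \<noteq> 0"
  shows "vec.span (range (($) M)) = UNIV"
proof -
  have "v \<in> vec.span (range (($) M))" for v
  proof -
    have "inverse (det M) *s (det M *s v) \<in> vec.span (range (($) M))"
      unfolding cramer_rows[OF assms, of v]
      by (intro vec.span_scale vec.span_sum vec.span_base rangeI)
    then show ?thesis using assms by simp
  qed
  then show ?thesis by blast
qed

text \<open>For (1, 4) in dimension 6 the flag members involved are \<open>K_6\<close> and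
  \<open>K_3\<close>: the first condition says that \<open>X\<close> has dimension at least 2, the
  second that \<open>X\<close> meets \<open>K_3\<close> nontrivially.\<close>

lemma Omega_J_2_2:
  fixes M :: "complex ^ 6 ^ 6"
  assumes "det M \<noteq> 0"
  shows "Omega 2 (J 2 2) (flag_of_matrix M) =
    {X. vec.subspace X \<and> vec.dim X = 2 \<and> 1 \<le> vec.dim (X \<inter> vec.span (range (\<lambda>h. M $ low h)))}"
proof -
  have "\<forall>r::6. idx r < 6" unfolding forall_6 by (simp add: idx_6)
  then have "{M $ r |r. idx r < 6} = range (($) M)" by auto
  then have f6: "flag_of_matrix M 6 = UNIV"
    unfolding flag_of_matrix_def using span_rows_UNIV[OF assms] by simp
  have f3: "flag_of_matrix M 3 = vec.span (range (\<lambda>h. M $ low h))"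
    unfolding flag_of_matrix_def idx_less_3_iff by (rule arg_cong[of _ _ vec.span]) auto
  have "{1..2} = {1, 2::nat}" by auto
  then show ?thesis
    unfolding Omega_def Grass_def by (auto simp: J_def f6 f3)
qed

text \<open>The four indices may be listed in any order, which later allows listing the points by
  their position on the real line.\<close>

lemma Inter_Omega_J_2_2:
  fixes M :: "4 \<Rightarrow> complex ^ 6 ^ 6"
  assumes "\<And>k. det (M k) \<noteq> 0" and i: "UNIV = {i1, i2, i3, i4}"
  shows "(\<Inter>k. Omega 2 (J 2 2) (flag_of_matrix (M k))) =
    {X. vec.subspace X \<and> vec.dim X = 2 \<and>
      (\<forall>Y\<in>{vec.span (range (\<lambda>h. M i1 $ low h)), vec.span (range (\<lambda>h. M i2 $ low h)),
            vec.span (range (\<lambda>h. M i3 $ low h)), vec.span (range (\<lambda>h. M i4 $ low h))}. 1 \<le> vec.dim (X \<inter> Y))}"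
  unfolding Omega_J_2_2[OF assms(1)] i by auto

lemma generic_count_J_2_2: "generic_count 2 (\<lambda>_::4. J 2 2) TYPE(6) 3"
proof -
  let ?row = "\<lambda>(x :: 4 \<times> 6 \<times> 6 \<Rightarrow> complex) k h. (\<chi> j. x (k, low h, j)) :: complex ^ 6"
  let ?g = "\<lambda>x. transversal_disc (?row x 1) (?row x 2) (?row x 3) (?row x 4)"
  have poly: "poly_fun ?g"
    by (intro poly_fun_transversal_disc) (simp_all add: poly_fun_var)
  have "nonzero_poly_fun ?g"
  proof (rule poly_fun_imp_nonzero_poly_fun[OF poly])
    \<comment> \<open>Witness for a nonzero value: \<open>?a\<close> and \<open>?b\<close> are the
      first and last three unit vectors, and 1, 2, 3 are distinct nonzero scalars.\<close>
    let ?l = "\<lambda>h::3. if h = 1 then 1 else if h = 2 then 2 else (3::complex)"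
    let ?a = "\<lambda>h. axis (low h) 1 :: complex ^ 6" and ?b = "\<lambda>h. axis (low h + 3) 1 :: complex ^ 6"
    define e where "e = (\<lambda>k h. if k = (1::4) then ?a h else if k = 2 then ?b h else if k = 3 then ?a h + ?b h
        else ?a h + ?l h *s ?b h)"
    \<comment> \<open>\<open>?row\<close> reads only positions in the range of \<open>low\<close>,
      where \<open>inv low\<close> recovers the index.\<close>
    define x where "x = (\<lambda>(k, i, j). e k (inv low i) $ j)"
    have "inj low" by (simp add: inj_def forall_3 low_def)
    then have "inv low (low h) = h" for h by (rule inv_f_f)
    then have "?row x k = e k" for k
      unfolding x_def by (simp add: vec_lambda_eta)
    then have row: "?row x 1 = ?a" "?row x 2 = ?b" "?row x 3 = (\<lambda>h. ?a h + ?b h)"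
      "?row x 4 = (\<lambda>h. ?a h + ?l h *s ?b h)"
      unfolding e_def by simp_all
    have "(\<chi> i. stack ?a ?b i) = mat 1"
      by (simp add: vec_eq_iff forall_6 mat_def axis_def low_def)
    then have "det (\<chi> i. stack ?a ?b i) \<noteq> 0" by simp
    then show "?g x \<noteq> 0"
      unfolding row by (rule transversal_disc_nonzero) (simp_all add: inj_def forall_3)
  qed
  moreover have "finite S \<and> card S = 3"
    if M: "\<forall>k. invertible (M k)" "?g (\<lambda>(k, i, j). M k $ i $ j) \<noteq> 0"
      and S: "S = (\<Inter>k. Omega 2 (J 2 2) (flag_of_matrix (M k)))" for M :: "4 \<Rightarrow> complex ^ 6 ^ 6" and S
  proof -
    have g: "transversal_disc (\<lambda>h. M 1 $ low h) (\<lambda>h. M 2 $ low h) (\<lambda>h. M 3 $ low h) (\<lambda>h. M 4 $ low h) \<noteq> 0"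
      using M(2) by simp
    have d: "det (M k) \<noteq> 0" for k using M(1) by (simp add: invertible_det_nz)
    show ?thesis
      unfolding S Inter_Omega_J_2_2[OF d UNIV_4] using card_transversals_span[OF g] by (rule conjI)
  qed
  ultimately show ?thesis unfolding generic_count_def Let_def by blast
qed

section \<open>Osculating flags\<close>

text \<open>In these weighted coordinates the row \<open>(1, s, \<dots>, s ^ 5)\<close> of the moment curve is the quintic
  \<open>(x + s) ^ 5\<close>, and the osculating 3-space at \<open>s\<close> consists of the quintics divisible by \<open>(x + s) ^ 3\<close>.\<close>
definition quintic_vec :: "'a::field_char_0 poly \<Rightarrow> 'a ^ 6" where
  "quintic_vec p = (\<chi> j. coeff p (5 - idx j) / of_nat (5 choose idx j))"

lemma quintic_vec_add: "quintic_vec (p + q) = quintic_vec p + quintic_vec q"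
  by (simp add: quintic_vec_def vec_eq_iff add_divide_distrib)

lemma quintic_vec_smult: "quintic_vec (smult c p) = c *s quintic_vec p"
  by (simp add: quintic_vec_def vec_eq_iff)

lemma quintic_vec_nth:
  "quintic_vec p $ 0 = coeff p 5" "quintic_vec p $ 1 = coeff p 4 / 5" "quintic_vec p $ 2 = coeff p 3 / 10"
  "quintic_vec p $ 3 = coeff p 2 / 10" "quintic_vec p $ 4 = coeff p 1 / 5" "quintic_vec p $ 5 = coeff p 0"
  unfolding quintic_vec_def vec_lambda_beta idx_6 by (simp_all add: numeral_eq_Suc)

lemma quintic_vec_eq_0:
  assumes "quintic_vec p = 0" "degree p \<le> 5"
  shows "p = 0"
proof (rule poly_eqI)
  fix n
  have c: "coeff p 5 = 0" "coeff p 4 = 0" "coeff p 3 = 0" "coeff p 2 = 0" "coeff p 1 = 0" "coeff p 0 = 0"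
    using assms(1) quintic_vec_nth[of p] by simp_all
  show "coeff p n = coeff 0 n"
  proof (cases "n \<le> 5")
    case True
    then have "n \<in> {5, 4, 3, 2, 1, 0}" by auto
    with c show ?thesis by (elim insertE emptyE) simp_all
  next
    case False
    then show ?thesis using assms(2) by (simp add: coeff_eq_0)
  qed
qed

lemma osc_matrix_rows:
  "osc_matrix s $ (0::6) $ 0 = 1" "osc_matrix s $ (0::6) $ 1 = s" "osc_matrix s $ (0::6) $ 2 = s ^ 2"
  "osc_matrix s $ (0::6) $ 3 = s ^ 3" "osc_matrix s $ (0::6) $ 4 = s ^ 4" "osc_matrix s $ (0::6) $ 5 = s ^ 5"
  "osc_matrix s $ (1::6) $ 0 = 0" "osc_matrix s $ (1::6) $ 1 = 1" "osc_matrix s $ (1::6) $ 2 = 2 * s"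
  "osc_matrix s $ (1::6) $ 3 = 3 * s ^ 2" "osc_matrix s $ (1::6) $ 4 = 4 * s ^ 3" "osc_matrix s $ (1::6) $ 5 = 5 * s ^ 4"
  "osc_matrix s $ (2::6) $ 0 = 0" "osc_matrix s $ (2::6) $ 1 = 0" "osc_matrix s $ (2::6) $ 2 = 1"
  "osc_matrix s $ (2::6) $ 3 = 3 * s" "osc_matrix s $ (2::6) $ 4 = 6 * s ^ 2" "osc_matrix s $ (2::6) $ 5 = 10 * s ^ 3"
  unfolding osc_matrix_def vec_lambda_beta idx_6 by (simp_all add: numeral_eq_Suc)

text \<open>The matrix is upper unitriangular: below the diagonal the truncated exponent is 0, but
  the binomial coefficient vanishes. A relation between the rows is therefore solved column by
  column.\<close>

lemma det_osc_matrix: "det (osc_matrix s :: complex ^ 6 ^ 6) \<noteq> 0"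
  unfolding det_nonzero_iff_rows
proof (intro allI impI)
  fix c :: "6 \<Rightarrow> complex" and i
  assume *: "\<forall>j. (\<Sum>i\<in>UNIV. c i * osc_matrix s $ i $ j) = 0"
  have m: "osc_matrix s $ r $ j = of_nat (idx j choose idx r) * s ^ (idx j - idx r)" for r j :: 6
    by (simp add: osc_matrix_def)
  note E = *[rule_format, unfolded sum_6 m idx_6]
  have 0: "c 0 = 0" using E[of 0] by (simp add: idx_6 binomial_eq_0)
  have 1: "c 1 = 0" using E[of 1] 0 by (simp add: idx_6 binomial_eq_0)
  have 2: "c 2 = 0" using E[of 2] 0 1 by (simp add: idx_6 binomial_eq_0)
  have 3: "c 3 = 0" using E[of 3] 0 1 2 by (simp add: idx_6 binomial_eq_0)
  have 4: "c 4 = 0" using E[of 4] 0 1 2 3 by (simp add: idx_6 binomial_eq_0)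
  have 5: "c 5 = 0" using E[of 5] 0 1 2 3 4 by (simp add: idx_6 binomial_eq_0)
  have "\<forall>i. c i = 0" unfolding forall_6 using 0 1 2 3 4 5 by simp
  then show "c i = 0" by blast
qed

text \<open>The first three rows represent \<open>(x + s) ^ 5\<close>,
  \<open>5 * (x + s) ^ 4\<close> and \<open>10 * (x + s) ^ 3\<close>. The coefficients come from
  expanding the quadratic factor in powers of \<open>x + s\<close>.\<close>

lemma quintic_vec_osculating:
  "quintic_vec ([:s, 1:] ^ 3 * [:a, b, c:]) = c *s osc_matrix s $ 0
     + ((b - 2 * c * s) / 5) *s osc_matrix s $ 1 + ((a - b * s + c * s ^ 2) / 10) *s osc_matrix s $ 2"
proof -
  have "[:s, 1:] ^ 3 * [:a, b, c:] = [:a * s ^ 3, 3 * a * s ^ 2 + b * s ^ 3, 3 * a * s + 3 * b * s ^ 2 + c * s ^ 3,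
      a + 3 * b * s + 3 * c * s ^ 2, b + 3 * c * s, c:]"
    by (simp add: power3_eq_cube power2_eq_square algebra_simps)
  then show ?thesis
    unfolding vec_eq_iff forall_6 vector_add_component vector_smult_component osc_matrix_rows quintic_vec_nth
    by (simp add: numeral_eq_Suc field_simps)
qed

lemma quintic_vec_in_osculating:
  assumes m: "m = smult u [:s, 1:]" and q: "degree q \<le> 2"
  shows "quintic_vec (m ^ 3 * q) \<in> vec.span (range (\<lambda>h. osc_matrix s $ low h))"
proof -
  let ?q = "smult (u ^ 3) q"
  have "?q = [:coeff ?q 0, coeff ?q 1, coeff ?q 2:]"
  proof (rule poly_eqI)
    fix n
    show "coeff ?q n = coeff [:coeff ?q 0, coeff ?q 1, coeff ?q 2:] n"
      using q by (cases "n \<le> 2") (auto simp: coeff_pCons coeff_eq_0 numeral_2_eq_2 le_Suc_eq split: nat.split)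
  qed
  moreover have "m ^ 3 * q = [:s, 1:] ^ 3 * ?q"
    unfolding m smult_power by (simp only: mult_smult_left mult_smult_right)
  moreover have "osc_matrix s $ 0 \<in> range (\<lambda>h. osc_matrix s $ low h)"
    "osc_matrix s $ 1 \<in> range (\<lambda>h. osc_matrix s $ low h)" "osc_matrix s $ 2 \<in> range (\<lambda>h. osc_matrix s $ low h)"
    using rangeI[of "\<lambda>h. osc_matrix s $ low h" 1] rangeI[of "\<lambda>h. osc_matrix s $ low h" 2]
      rangeI[of "\<lambda>h. osc_matrix s $ low h" 3] by (simp_all add: low_def)
  ultimately show ?thesis
    using quintic_vec_osculating[of s "coeff ?q 0" "coeff ?q 1" "coeff ?q 2"]
    by (metis vec.span_add vec.span_scale vec.span_base)
qed

section \<open>Monomials in two linear forms \<open>p\<close> and \<open>q\<close>\<close>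

definition upper_basis :: "'a::field_char_0 poly \<Rightarrow> 'a poly \<Rightarrow> 3 \<Rightarrow> 'a ^ 6" where
  "upper_basis p q h = quintic_vec (p ^ 3 * (if h = 1 then p ^ 2 else if h = 2 then p * q else q ^ 2))"

text \<open>The two families together are the six monomials from \<open>p ^ 5\<close> to
  \<open>q ^ 5\<close>; each one spans the multiples of a cube.\<close>

definition lower_basis :: "'a::field_char_0 poly \<Rightarrow> 'a poly \<Rightarrow> 3 \<Rightarrow> 'a ^ 6" where
  "lower_basis p q h = quintic_vec (q ^ 3 * (if h = 1 then p ^ 2 else if h = 2 then p * q else q ^ 2))"

text \<open>Evaluation at the zero \<open>t\<close> of \<open>p\<close> leaves only the pure power
  of \<open>q\<close>; afterwards \<open>p\<close> can be cancelled.\<close>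

lemma binary_form_step:
  fixes p q G :: "'a::field poly"
  assumes "p * G + smult c (q ^ n) = 0" "p \<noteq> 0" "poly p t = 0" "poly q t \<noteq> 0"
  shows "c = 0 \<and> G = 0"
proof -
  have "poly (p * G + smult c (q ^ n)) t = 0" by (simp only: assms(1) poly_0)
  then have "c = 0" using assms(3,4) by simp
  then show ?thesis using assms(1,2) by simp
qed

text \<open>A relation is a binary quintic form in \<open>p\<close> and \<open>q\<close> that
  vanishes. Its coefficients are peeled off one at a time, starting from
  \<open>q ^ 5\<close>.\<close>

lemma bases_independent:
  fixes p q :: "'a::field_char_0 poly"
  assumes pq: "p \<noteq> 0" "poly p t = 0" "poly q t \<noteq> 0" and deg: "degree p \<le> 1" "degree q \<le> 1"
    and 0: "(\<Sum>i\<in>UNIV. x i *s upper_basis p q i) + (\<Sum>i\<in>UNIV. y i *s lower_basis p q i) = 0"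
  shows "\<forall>i. x i = 0 \<and> y i = 0"
proof -
  let ?F = "smult (x 1) (p ^ 3 * p ^ 2) + smult (x 2) (p ^ 3 * (p * q)) + smult (x 3) (p ^ 3 * q ^ 2)
    + (smult (y 1) (q ^ 3 * p ^ 2) + smult (y 2) (q ^ 3 * (p * q)) + smult (y 3) (q ^ 3 * q ^ 2))"
  have "quintic_vec ?F = 0"
    using 0 by (simp add: sum_3 upper_basis_def lower_basis_def quintic_vec_add quintic_vec_smult)
  moreover have "degree ?F \<le> 5"
  proof -
    have d: "degree (p ^ i * q ^ j) \<le> 5" if "i + j = 5" for i j
    proof -
      have "degree (p ^ i * q ^ j) \<le> degree p * i + degree q * j"
        by (rule order_trans[OF degree_mult_le add_mono[OF degree_power_le degree_power_le]])
      also have "\<dots> \<le> 1 * i + 1 * j" using deg by (intro add_mono mult_right_mono) auto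
      finally show ?thesis using that by simp
    qed
    have e: "p ^ 3 * p ^ 2 = p ^ 5 * q ^ 0" "p ^ 3 * (p * q) = p ^ 4 * q ^ 1" "q ^ 3 * p ^ 2 = p ^ 2 * q ^ 3"
      "q ^ 3 * (p * q) = p ^ 1 * q ^ 4" "q ^ 3 * q ^ 2 = p ^ 0 * q ^ 5"
      by algebra+
    show ?thesis
      unfolding e by (intro degree_add_le order_trans[OF degree_smult_le] d) simp_all
  qed
  ultimately have F: "?F = 0" by (rule quintic_vec_eq_0)
  note step = binary_form_step[OF _ pq]
  let ?s = "\<lambda>c m. smult c m"
  have "p * (?s (x 1) (p ^ 4) + ?s (x 2) (p ^ 3 * q) + ?s (x 3) (p ^ 2 * q ^ 2) + ?s (y 1) (p * q ^ 3) + ?s (y 2) (q ^ 4))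
      + ?s (y 3) (q ^ 5) = 0"
    using F by (simp add: algebra_simps eval_nat_numeral)
  from step[OF this] have y3: "y 3 = 0"
    and "p * (?s (x 1) (p ^ 3) + ?s (x 2) (p ^ 2 * q) + ?s (x 3) (p * q ^ 2) + ?s (y 1) (q ^ 3)) + ?s (y 2) (q ^ 4) = 0"
    by (simp_all add: algebra_simps eval_nat_numeral)
  from step[OF this(2)] have y2: "y 2 = 0"
    and "p * (?s (x 1) (p ^ 2) + ?s (x 2) (p * q) + ?s (x 3) (q ^ 2)) + ?s (y 1) (q ^ 3) = 0"
    by (simp_all add: algebra_simps eval_nat_numeral)
  from step[OF this(2)] have y1: "y 1 = 0"
    and "p * (?s (x 1) p + ?s (x 2) q) + ?s (x 3) (q ^ 2) = 0"
    by (simp_all add: algebra_simps eval_nat_numeral)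
  from step[OF this(2)] have x3: "x 3 = 0" and "p * ?s (x 1) 1 + ?s (x 2) (q ^ 1) = 0"
    by (simp_all add: algebra_simps eval_nat_numeral)
  from step[OF this(2)] have "x 2 = 0" "x 1 = 0" by simp_all
  with x3 y1 y2 y3 show ?thesis unfolding forall_3 by simp
qed

text \<open>The basis of the quintics divisible by \<open>(p + t * q) ^ 3\<close>, with upper part reduced to the identity,
  has this lower part.\<close>
definition osc_matrix_lower :: "'a::field \<Rightarrow> 'a ^ 3 ^ 3" where
  "osc_matrix_lower t = (\<chi> h j.
     if h = 1 then (if j = 1 then 10 * t ^ 3 else if j = 2 then 15 * t ^ 4 else 6 * t ^ 5)
     else if h = 2 then (if j = 1 then - 6 * t ^ 2 else if j = 2 then - 8 * t ^ 3 else - 3 * t ^ 4)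
     else (if j = 1 then 3 * t else if j = 2 then 3 * t ^ 2 else t ^ 3))"

lemma osc_matrix_lower_in_osculating:
  assumes m: "p + smult t q = smult u [:s, 1:]" and deg: "degree p \<le> 1" "degree q \<le> 1"
  shows "1 *s upper_basis p q h + (\<Sum>j\<in>UNIV. osc_matrix_lower t $ h $ j *s lower_basis p q j)
    \<in> vec.span (range (\<lambda>h. osc_matrix s $ low h))"
proof -
  \<comment> \<open>The coefficients 1, -3, 6 are those of the series of
    \<open>(1 + y) ^ (-3)\<close>. Multiplying by its truncation cancels every other upper monomial
    in the product with \<open>(p + t * q) ^ 3\<close>.\<close>
  define r where "r = (if h = 1 then p * p + smult (- 3 * t) (p * q) + smult (6 * t ^ 2) (q * q)
    else if h = 2 then p * q + smult (- 3 * t) (q * q) else q * q)"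
  have "degree (f * g) \<le> 2" if "f \<in> {p, q}" "g \<in> {p, q}" for f g
    using degree_mult_le[of f g] that deg by auto
  then have deg: "degree r \<le> 2"
    unfolding r_def by (auto intro!: degree_add_le degree_diff_le order_trans[OF degree_smult_le])
  have "1 *s upper_basis p q h + (\<Sum>j\<in>UNIV. osc_matrix_lower t $ h $ j *s lower_basis p q j)
    = quintic_vec (p ^ 3 * (if h = 1 then p ^ 2 else if h = 2 then p * q else q ^ 2)
        + smult (osc_matrix_lower t $ h $ 1) (q ^ 3 * p ^ 2)
        + smult (osc_matrix_lower t $ h $ 2) (q ^ 3 * (p * q))
        + smult (osc_matrix_lower t $ h $ 3) (q ^ 3 * q ^ 2))"
    by (simp add: sum_3 upper_basis_def lower_basis_def quintic_vec_add quintic_vec_smult add.assoc)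
  also have "p ^ 3 * (if h = 1 then p ^ 2 else if h = 2 then p * q else q ^ 2)
        + smult (osc_matrix_lower t $ h $ 1) (q ^ 3 * p ^ 2)
        + smult (osc_matrix_lower t $ h $ 2) (q ^ 3 * (p * q))
        + smult (osc_matrix_lower t $ h $ 3) (q ^ 3 * q ^ 2) = (p + smult t q) ^ 3 * r" (is "?l = ?r")
  proof -
    have I: "X ^ 3 * X ^ 2 + (10 * t ^ 3) * (Y ^ 3 * X ^ 2) + (15 * t ^ 4) * (Y ^ 3 * (X * Y)) + (6 * t ^ 5) * (Y ^ 3 * Y ^ 2)
        = (X + t * Y) ^ 3 * (X * X + (- 3 * t) * (X * Y) + (6 * t ^ 2) * (Y * Y))"
      "X ^ 3 * (X * Y) + (- 6 * t ^ 2) * (Y ^ 3 * X ^ 2) + (- 8 * t ^ 3) * (Y ^ 3 * (X * Y)) + (- 3 * t ^ 4) * (Y ^ 3 * Y ^ 2)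
        = (X + t * Y) ^ 3 * (X * Y + (- 3 * t) * (Y * Y))"
      "X ^ 3 * Y ^ 2 + (3 * t) * (Y ^ 3 * X ^ 2) + (3 * t ^ 2) * (Y ^ 3 * (X * Y)) + t ^ 3 * (Y ^ 3 * Y ^ 2)
        = (X + t * Y) ^ 3 * (Y * Y)" for X Y
      by algebra+
    \<comment> \<open>Over an infinite field it suffices to compare values, where the scalar
      identities \<open>I\<close> apply.\<close>
    have "poly ?l x = poly ?r x" for x
    proof -
      note poly = poly_add poly_mult poly_smult poly_power
      consider "h = 1" | "h = 2" | "h = 3" using exhaust_3[of h] by blast
      then show ?thesis
      proof cases
        case 1
        show ?thesis using I(1)[of "poly p x" "poly q x"]
          unfolding r_def osc_matrix_lower_def 1 by (simp only: poly vec_lambda_beta) simp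
      next
        case 2
        show ?thesis using I(2)[of "poly p x" "poly q x"]
          unfolding r_def osc_matrix_lower_def 2 by (simp only: poly vec_lambda_beta) simp
      next
        case 3
        show ?thesis using I(3)[of "poly p x" "poly q x"]
          unfolding r_def osc_matrix_lower_def 3 by (simp only: poly vec_lambda_beta) simp
      qed
    qed
    then show ?thesis by (simp add: poly_eq_poly_eq_iff[symmetric] fun_eq_iff)
  qed
  finally show ?thesis using quintic_vec_in_osculating[OF m deg] by simp
qed

lemma upper_basis_in_osculating:
  assumes "p = smult u [:s, 1:]" "degree p \<le> 1" "degree q \<le> 1"
  shows "upper_basis p q h \<in> vec.span (range (\<lambda>h. osc_matrix s $ low h))"
proof -
  have "degree (f * g) \<le> 2" if "f \<in> {p, q}" "g \<in> {p, q}" for f g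
    using degree_mult_le[of f g] that assms(2,3) by auto
  then show ?thesis
    unfolding upper_basis_def by (intro quintic_vec_in_osculating[OF assms(1)]) (auto simp: power2_eq_square)
qed

lemma lower_basis_in_osculating:
  assumes "q = smult u [:s, 1:]" "degree p \<le> 1" "degree q \<le> 1"
  shows "lower_basis p q h \<in> vec.span (range (\<lambda>h. osc_matrix s $ low h))"
proof -
  have "degree (f * g) \<le> 2" if "f \<in> {p, q}" "g \<in> {p, q}" for f g
    using degree_mult_le[of f g] that assms(2,3) by auto
  then show ?thesis
    unfolding lower_basis_def by (intro quintic_vec_in_osculating[OF assms(1)]) (auto simp: power2_eq_square)
qed

lemma det_osc_matrix_lower: "det (osc_matrix_lower t) = t ^ 9"
  unfolding det_3 osc_matrix_lower_def by simp algebra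

section \<open>Reality of the bases and of the eigenvalues\<close>

lemma quintic_vec_real:
  assumes "\<And>n. coeff p n \<in> \<real>"
  shows "Im (quintic_vec p $ j) = 0"
proof -
  have "quintic_vec p $ j \<in> \<real>"
    unfolding quintic_vec_def vec_lambda_beta using assms by (intro Reals_divide Reals_of_nat)
  then show ?thesis by (simp add: complex_is_Real_iff)
qed

lemma coeff_mult_Reals:
  fixes p q :: "complex poly"
  assumes "\<And>n. coeff p n \<in> \<real>" "\<And>n. coeff q n \<in> \<real>"
  shows "coeff (p * q) n \<in> \<real>"
  unfolding coeff_mult using assms by (intro sum_in_Reals Reals_mult)

lemma bases_real:
  fixes p q :: "complex poly"
  assumes "\<And>n. coeff p n \<in> \<real>" "\<And>n. coeff q n \<in> \<real>"
  shows "Im (upper_basis p q h $ j) = 0" "Im (lower_basis p q h $ j) = 0"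
  unfolding upper_basis_def lower_basis_def
  by (auto intro!: quintic_vec_real coeff_mult_Reals simp: assms power2_eq_square power3_eq_cube)

text \<open>Up to the factor \<open>t ^ 2\<close>, the determinant is a cubic in \<open>\<mu> = \<lambda> * t ^ 3\<close>; for negative \<open>t\<close>
  it changes sign between 0, 1/10, 10 and infinity.\<close>
lemma osculating_pencil_real_roots:
  fixes t :: real
  assumes t: "t < 0"
  obtains lam :: "3 \<Rightarrow> real" where "inj lam"
    "\<And>i. det (\<chi> h j. osc_matrix_lower 1 $ h $ j - lam i * osc_matrix_lower t $ h $ j) = 0"
proof -
  define U where "U = 36 * t ^ 4 - 90 * t ^ 3 + 84 * t ^ 2 - 36 * t + 9"
  define V where "V = 9 * t ^ 4 - 36 * t ^ 3 + 84 * t ^ 2 - 90 * t + 36"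
  let ?p = "[:t ^ 2, - U, V, - (t ^ 2):]"
  have p: "poly ?p (t ^ 3 * x) = t ^ 2 * det (\<chi> h j. osc_matrix_lower 1 $ h $ j - x * osc_matrix_lower t $ h $ j)" for x
    unfolding det_3 osc_matrix_lower_def U_def V_def by simp algebra
  have pos: "t ^ 2 > 0" "t ^ 3 < 0" "t ^ 4 > 0"
    using t by (simp_all add: power3_eq_cube power2_eq_square power4_eq_xxxx mult_neg_neg mult_pos_neg)
  have UV: "U > 0" "V > 84 * t ^ 2" unfolding U_def V_def using pos t by linarith+
  \<comment> \<open>With \<open>U\<close> and \<open>V\<close> expanded in powers of
    \<open>t\<close>, every term is negative for \<open>t < 0\<close>; at 10 every term is
    positive.\<close>
  have "1000 * poly ?p (1 / 10) = 999 * t ^ 2 - 100 * U + 10 * V" by (simp add: field_simps)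
  then have p01: "poly ?p (1 / 10) < 0" using U_def V_def pos t by linarith
  have "poly ?p 0 > 0" using pos by simp
  with p01 obtain r1 where r1: "0 < r1" "r1 < 1 / 10" "poly ?p r1 = 0"
    using poly_IVT_neg[of 0 "1 / 10" ?p] by auto
  have "poly ?p 10 = 100 * V - 999 * t ^ 2 - 10 * U" by (simp add: field_simps)
  then have p10: "poly ?p 10 > 0" using U_def V_def pos t by linarith
  with p01 obtain r2 where r2: "1 / 10 < r2" "r2 < 10" "poly ?p r2 = 0"
    using poly_IVT_pos[of "1 / 10" 10 ?p] by auto
  \<comment> \<open>Chosen so that \<open>V - t ^ 2 * m = - (t ^ 2)\<close>, which makes the two
    leading terms of the cubic negative together.\<close>
  define m where "m = V / t ^ 2 + 1"
  have "9 * t ^ 2 < V" using UV(2) pos(1) by linarith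
  then have m: "m > 10" "t ^ 2 * m = V + t ^ 2" using t by (auto simp: m_def field_simps)
  have "poly ?p m = t ^ 2 - U * m + m ^ 2 * (V - t ^ 2 * m)"
    by (simp add: algebra_simps power2_eq_square)
  also have "\<dots> = t ^ 2 * (1 - m ^ 2) - U * m" unfolding m(2) by (simp add: algebra_simps)
  also have "\<dots> < 0"
  proof -
    have "1 < m ^ 2" using m(1) by (simp add: one_less_power)
    then have "t ^ 2 * (1 - m ^ 2) < 0" using pos by (simp add: mult_pos_neg)
    moreover have "U * m > 0" using UV m by simp
    ultimately show ?thesis by linarith
  qed
  finally obtain r3 where r3: "10 < r3" "poly ?p r3 = 0"
    using poly_IVT_neg[of 10 m ?p] m(1) p10 by auto
  show thesis
  proof
    let ?r = "\<lambda>i::3. if i = 1 then r1 else if i = 2 then r2 else r3"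
    let ?l = "\<lambda>i. ?r i / t ^ 3"
    show "inj ?l" using r1 r2 r3 t by (simp add: inj_def forall_3)
    fix i
    have "poly ?p (t ^ 3 * ?l i) = 0" using r1 r2 r3 t by simp
    then show "det (\<chi> h j. osc_matrix_lower 1 $ h $ j - ?l i * osc_matrix_lower t $ h $ j) = 0"
      unfolding p using t by simp
  qed
qed

section \<open>Osculating 3-spaces at four interlacing real points\<close>

lemma real_osculating_transversals:
  fixes s1 s2 s3 s4 :: real
  assumes s: "s1 < s3" "s3 < s2" "s2 < s4"
  defines "K \<equiv> \<lambda>s. vec.span (range (\<lambda>h. osc_matrix (complex_of_real s) $ low h)) :: (complex ^ 6) set"
  defines "S \<equiv> {X. vec.subspace X \<and> vec.dim X = 2 \<and> (\<forall>Y\<in>{K s1, K s2, K s3, K s4}. 1 \<le> vec.dim (X \<inter> Y))}"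
  shows "finite S" "card S = 3" "\<forall>X\<in>S. real_subspace X"
proof -
  \<comment> \<open>The cross ratio for which \<open>p + t * q\<close> is proportional to the linear
    form of \<open>s4\<close>. The linear forms of \<open>s1\<close> and \<open>s2\<close> are
    scaled below so that \<open>p + q\<close> is proportional to that of \<open>s3\<close>.\<close>
  define t where "t = (s1 - s4) * (s3 - s2) / ((s1 - s3) * (s4 - s2))"
  have t: "t < 0" unfolding t_def using s by (intro divide_pos_neg mult_neg_neg mult_neg_pos) auto
  let ?c = complex_of_real
  define p where "p = smult (?c (s3 - s2)) [:?c s1, 1:]"
  define q where "q = smult (?c (s1 - s3)) [:?c s2, 1:]"
  have pq3: "p + smult 1 q = smult (?c (s1 - s2)) [:?c s3, 1:]"
    by (simp add: p_def q_def algebra_simps)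
  define v where "v = (s3 - s2) * (s1 - s2) / (s4 - s2)"
  have e4: "(s3 - s2) + t * (s1 - s3) = v" "(s3 - s2) * s1 + t * ((s1 - s3) * s2) = v * s4"
  proof -
    have t': "(s4 - s2) * (t * (s1 - s3)) = (s1 - s4) * (s3 - s2)"
      unfolding t_def using s by simp
    have v': "(s4 - s2) * v = (s3 - s2) * (s1 - s2)"
      unfolding v_def using s by simp
    have "(s4 - s2) * ((s3 - s2) + t * (s1 - s3)) = (s4 - s2) * v"
      "(s4 - s2) * ((s3 - s2) * s1 + t * ((s1 - s3) * s2)) = (s4 - s2) * (v * s4)"
      using t' v' by algebra+
    then show "(s3 - s2) + t * (s1 - s3) = v" "(s3 - s2) * s1 + t * ((s1 - s3) * s2) = v * s4"
      using s by simp_all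
  qed
  have pq4: "p + smult (?c t) q = smult (?c v) [:?c s4, 1:]"
    unfolding p_def q_def using e4[THEN arg_cong[where f = ?c]] by simp
  have deg: "degree p \<le> 1" "degree q \<le> 1"
    unfolding p_def q_def by (auto intro: order_trans[OF degree_smult_le])
  have pne: "p \<noteq> 0" "poly p (- ?c s1) = 0" "poly q (- ?c s1) \<noteq> 0"
    unfolding p_def q_def using s by simp_all
  have pr: "coeff p n \<in> \<real>" "coeff q n \<in> \<real>" for n
    unfolding p_def q_def by (auto simp: coeff_pCons simp flip: of_real_diff of_real_mult split: nat.split)
  obtain lam :: "3 \<Rightarrow> real" where lam: "inj lam"
    and root: "\<And>i. det (\<chi> h j. osc_matrix_lower 1 $ h $ j - lam i * osc_matrix_lower t $ h $ j) = 0"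
    using osculating_pencil_real_roots[OF t] by blast
  \<comment> \<open>The kernel vectors are taken over the reals, so that the resulting planes have
    real spanning vectors.\<close>
  have "\<exists>c. (\<forall>j. (\<Sum>h\<in>UNIV. c h * (osc_matrix_lower 1 $ h $ j - lam i * osc_matrix_lower t $ h $ j)) = 0) \<and> (\<exists>h. c h \<noteq> 0)" for i
    using root[of i] det_nonzero_iff_rows[of "\<chi> h j. osc_matrix_lower 1 $ h $ j - lam i * osc_matrix_lower t $ h $ j"] by auto
  then have "\<forall>i. \<exists>c. (\<forall>j. (\<Sum>h\<in>UNIV. c h * (osc_matrix_lower 1 $ h $ j - lam i * osc_matrix_lower t $ h $ j)) = 0) \<and> (\<exists>h. c h \<noteq> 0)"
    by blast
  from choice[OF this] obtain z where z: "\<And>i. \<exists>h. z i h \<noteq> 0"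
    and eig: "\<And>i j. (\<Sum>h\<in>UNIV. z i h * (osc_matrix_lower 1 $ h $ j - lam i * osc_matrix_lower t $ h $ j)) = 0"
    by blast
  have lc: "osc_matrix_lower (?c x) $ h $ j = ?c (osc_matrix_lower x $ h $ j)" for x h j
    by (simp add: osc_matrix_lower_def)
  have eig': "(\<Sum>h\<in>UNIV. ?c (z i h) * osc_matrix_lower (?c 1) $ h $ j)
      = ?c (lam i) * (\<Sum>h\<in>UNIV. ?c (z i h) * osc_matrix_lower (?c t) $ h $ j)" for i j
  proof -
    have "(\<Sum>h\<in>UNIV. z i h * osc_matrix_lower 1 $ h $ j) = lam i * (\<Sum>h\<in>UNIV. z i h * osc_matrix_lower t $ h $ j)"
      using eig[where i = i and j = j] by (simp add: sum_3 algebra_simps)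
    from arg_cong[OF this, of ?c] show ?thesis unfolding lc by simp
  qed
  have z': "\<exists>h. ?c (z i h) \<noteq> 0" for i using z[of i] by simp
  have lam': "inj (\<lambda>i. ?c (lam i))" using lam by (simp add: inj_def)
  have d: "det (osc_matrix_lower (?c 1)) \<noteq> 0" "det (osc_matrix_lower (?c t)) \<noteq> 0"
    unfolding det_osc_matrix_lower using t by simp_all
  have ind: "\<forall>i. x i = 0 \<and> y i = 0"
    if "(\<Sum>i\<in>UNIV. x i *s upper_basis p q i) + (\<Sum>i\<in>UNIV. y i *s lower_basis p q i) = 0" for x y
    by (rule bases_independent[OF pne deg that])
  have mem: "upper_basis p q h \<in> K s1" "lower_basis p q h \<in> K s2"
    "1 *s upper_basis p q h + (\<Sum>j\<in>UNIV. osc_matrix_lower (?c 1) $ h $ j *s lower_basis p q j) \<in> K s3"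
    "1 *s upper_basis p q h + (\<Sum>j\<in>UNIV. osc_matrix_lower (?c t) $ h $ j *s lower_basis p q j) \<in> K s4" for h
    unfolding K_def
    by (rule upper_basis_in_osculating[OF p_def deg])
      (rule lower_basis_in_osculating[OF q_def deg]
        osc_matrix_lower_in_osculating[OF _ deg] pq4 | simp only: of_real_1 pq3)+
  have K: "vec.subspace (K s)" "vec.dim (K s) \<le> 3" for s
    unfolding K_def by (rule vec.subspace_span, rule dim_span_range_le)
  note R = transversals_pencil[OF ind d lam' one_neq_zero one_neq_zero z' eig' K(1) K(1) K(1) K(1)
      K(2) K(2) K(2) K(2) mem]
  let ?F = "\<lambda>i. vec.span {\<Sum>h\<in>UNIV. (1 * ?c (z i h)) *s upper_basis p q h,
    \<Sum>j\<in>UNIV. (\<Sum>h\<in>UNIV. ?c (z i h) * osc_matrix_lower (?c 1) $ h $ j) *s lower_basis p q j}"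
  have S: "S = range ?F" unfolding S_def by (rule R(1))
  have "inj ?F" by (rule R(2))
  show "finite S" unfolding S by (rule finite_imageI[OF finite])
  show "card S = 3" unfolding S card_image[OF \<open>inj ?F\<close>] by simp
  have im: "Im (osc_matrix_lower 1 $ h $ j) = 0" for h j using lc[of 1 h j] by simp
  have "real_subspace (?F i)" for i
    unfolding real_subspace_def
    by (rule exI, rule conjI[OF _ refl]) (simp add: im bases_real[OF pr])
  then show "\<forall>X\<in>S. real_subspace X" unfolding S by blast
qed

lemma four_distinct_reals_sorted:
  fixes s :: "4 \<Rightarrow> real"
  assumes "inj s"
  obtains i1 i2 i3 i4 where "UNIV = {i1, i2, i3, i4}" "s i1 < s i2" "s i2 < s i3" "s i3 < s i4"
proof -
  define xs where "xs = sort_key s [1, 2, 3, 4]"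
  have xs: "length xs = 4" "set xs = UNIV" "distinct xs" "sorted (map s xs)"
    unfolding xs_def UNIV_4 by (simp_all del: sort_key_simps)
  from xs(1) obtain i1 i2 i3 i4 where "xs = [i1, i2, i3, i4]"
    by (auto simp: numeral_eq_Suc length_Suc_conv)
  with xs that[of i1 i2 i3 i4] assms show thesis by (auto simp: inj_eq order_less_le)
qed

lemma SG_J_2_2: "SG 2 (\<lambda>_::4. J 2 2) TYPE(6) 3"
proof -
  \<comment> \<open>The constant 1 suffices: every choice of four distinct real points is
    good.\<close>
  have "nonzero_poly_fun (\<lambda>_ :: 4 \<Rightarrow> real. 1 :: real)"
    by (rule poly_fun_imp_nonzero_poly_fun[OF poly_fun_const]) simp
  moreover have "finite S \<and> card S = 3 \<and> (\<forall>X\<in>S. real_subspace X)"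
    if s: "inj s" and S: "S = (\<Inter>k. Omega 2 (J 2 2) (osc_flag (complex_of_real (s k))))"
    for s :: "4 \<Rightarrow> real" and S :: "(complex ^ 6) set set"
  proof -
    obtain i1 i2 i3 i4 where i: "UNIV = {i1, i2, i3, i4}" "s i1 < s i2" "s i2 < s i3" "s i3 < s i4"
      by (rule four_distinct_reals_sorted[OF s])
    \<comment> \<open>The first and third points in increasing order take the roles of
      \<open>A\<close> and \<open>B\<close>, which makes the pairs interlace.\<close>
    have "UNIV = {i1, i3, i2, i4}" using i(1) by auto
    from real_osculating_transversals[OF i(2-4)] show ?thesis
      unfolding S osc_flag_def Inter_Omega_J_2_2[OF det_osc_matrix \<open>UNIV = {i1, i3, i2, i4}\<close>]
      by (intro conjI)
  qed
  ultimately show ?thesis unfolding SG_def Let_def by (intro exI[of _ "\<lambda>_. 1"]) auto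
qed

theorem mainTheorem9:
  shows "generic_count 2 (\<lambda>_::4. J 2 2) TYPE(6) 3 \<and> SG 2 (\<lambda>_::4. J 2 2) TYPE(6) 3"
  using generic_count_J_2_2 SG_J_2_2 by (rule conjI)

end
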